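(* Let $G$ be a solvable group of real analytic diffeomorphisms of a connected real analytic manifold $M^n$ of dimension $n$. Suppose that $G$ has a global fixed point $p$, i.e. $p\in M^n$ is a fixed point of every element of $G$. Then $\ell(G)\le\psi(n)$.
   Context: For a group $G$, put $G^{(0)}=G$ and $G^{(j)}=[G^{(j-1)},G^{(j-1)}]$ for $j\ge 1$. The derived length is $\ell(G)=\min\{k\ge 0: G^{(k)}\text{ is trivial}\}$ ($\infty$ if there is no such $k$), and $G$ is solvable if $\ell(G)<\infty$. $\mathrm{Diff}(\mathbb{C}^n,0)$ is the group of germs at $0\in\mathbb{C}^n$ of complex analytic diffeomorphisms fixing $0$, and $\psi(n)=\max\{\ell(H): H\text{ is a solvable subgroup of }\mathrm{Diff}(\mathbb{C}^n,0)\}$ (it is known that this maximum is finite). *)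

theory Defs
  imports
    "HOL-Analysis.Analysis"
    "HOL-Library.Extended_Nat"
    "HOL-Algebra.Bij"
    "HOL-Algebra.Solvable_Groups"
begin

section \<open>Derived length\<close>

definition derived_length :: "('a, 'b) monoid_scheme \<Rightarrow> enat" where
  "derived_length G = Inf {enat k | k. (derived G ^^ k) (carrier G) = {\<one>\<^bsub>G\<^esub>}}"

text \<open>In \<^typ>\<open>enat\<close> the infimum of a nonempty set is its minimum, and the infimum of the empty
  set is \<open>\<infinity>\<close>.  Finite derived length is solvability in the sense of HOL-Algebra:\<close>

lemma (in group) derived_length_finite_iff_solvable:
  "derived_length G < \<infinity> \<longleftrightarrow> solvable G"
proof -
  have "derived_length G < \<infinity> \<longleftrightarrow> (\<exists>k. (derived G ^^ k) (carrier G) = {\<one>})"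
    unfolding derived_length_def Inf_less_iff by auto
  then show ?thesis
    by (simp add: solvable_iff_trivial_derived_seq)
qed

section \<open>Analytic maps in real and complex coordinate spaces\<close>

text \<open>The field \<open>'k\<close> is meant to be \<^typ>\<open>real\<close> or \<^typ>\<open>complex\<close>.  As for
  \<^const>\<open>Euclidean_space\<close>, the \<open>n\<close>-dimensional space consists of the sequences that vanish
  from index \<open>n\<close> on.\<close>

definition coord_space :: "nat \<Rightarrow> (nat \<Rightarrow> 'k::real_normed_field) topology" where
  "coord_space n = subtopology (product_topology (\<lambda>_. euclidean) UNIV) {x. \<forall>i\<ge>n. x i = 0}"

lemma coord_space_real: "coord_space n = Euclidean_space n"
  by (simp add: coord_space_def Euclidean_space_def)

definition multi_indices :: "nat \<Rightarrow> (nat \<Rightarrow> nat) set" where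
  "multi_indices n = {\<alpha>. \<forall>i\<ge>n. \<alpha> i = 0}"

text \<open>\<open>f\<close> is the sum of a power series on some polydisc centred at \<open>a\<close>; shrinking
  the polydisc, only the values of \<open>f\<close> near \<open>a\<close> matter.\<close>

definition analytic_fun_at ::
    "nat \<Rightarrow> ((nat \<Rightarrow> 'k::real_normed_field) \<Rightarrow> 'k) \<Rightarrow> (nat \<Rightarrow> 'k) \<Rightarrow> bool" where
  "analytic_fun_at n f a \<longleftrightarrow>
     (\<exists>r>0. \<exists>c. \<forall>y\<in>topspace (coord_space n). (\<forall>i<n. norm (y i - a i) < r) \<longrightarrow>
        ((\<lambda>\<alpha>. c \<alpha> * (\<Prod>i<n. (y i - a i) ^ \<alpha> i)) has_sum f y) (multi_indices n))"

definition analytic_map ::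
    "nat \<Rightarrow> (nat \<Rightarrow> 'k::real_normed_field) set \<Rightarrow> ((nat \<Rightarrow> 'k) \<Rightarrow> nat \<Rightarrow> 'k) \<Rightarrow> bool" where
  "analytic_map n U f \<longleftrightarrow> (\<forall>a\<in>U. \<forall>i<n. analytic_fun_at n (\<lambda>x. f x i) a)"

definition analytic_diffeo ::
    "nat \<Rightarrow> (nat \<Rightarrow> 'k::real_normed_field) set \<Rightarrow> (nat \<Rightarrow> 'k) set \<Rightarrow>
      ((nat \<Rightarrow> 'k) \<Rightarrow> nat \<Rightarrow> 'k) \<Rightarrow> bool" where
  "analytic_diffeo n U V f \<longleftrightarrow>
     openin (coord_space n) U \<and> openin (coord_space n) V \<and> bij_betw f U V \<and>
     analytic_map n U f \<and> analytic_map n V (inv_into U f)"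

section \<open>Germs of complex analytic diffeomorphisms\<close>

abbreviation origin :: "nat \<Rightarrow> complex" where
  "origin \<equiv> \<lambda>_. 0"

definition germ :: "nat \<Rightarrow> ((nat \<Rightarrow> complex) \<Rightarrow> nat \<Rightarrow> complex) \<Rightarrow>
    ((nat \<Rightarrow> complex) \<Rightarrow> nat \<Rightarrow> complex) set" where
  "germ n f = {g. eventually (\<lambda>x. g x = f x) (nhdsin (coord_space n) origin)}"

text \<open>In the product below, \<open>germ n (f \<circ> g)\<close> does not depend on the representatives \<open>f\<close> and
  \<open>g\<close>, so that the union is a single germ.\<close>

definition Diff_germs ::
    "nat \<Rightarrow> ((nat \<Rightarrow> complex) \<Rightarrow> nat \<Rightarrow> complex) set monoid" where
  "Diff_germs n =
     \<lparr>carrier = {germ n f | f U V. analytic_diffeo n U V f \<and> origin \<in> U \<and> f origin = origin},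
      mult = (\<lambda>\<phi> \<psi>. \<Union>f\<in>\<phi>. \<Union>g\<in>\<psi>. germ n (f \<circ> g)),
      one = germ n id\<rparr>"

text \<open>The maximum of the derived lengths of the solvable subgroups is taken as a supremum in
  \<^typ>\<open>enat\<close>: the two agree whenever the lengths are bounded, and the supremum makes sense
  without appeal to the theorem that they are.\<close>

definition psi :: "nat \<Rightarrow> enat" where
  "psi n = Sup {derived_length (Diff_germs n\<lparr>carrier := H\<rparr>) | H.
     subgroup H (Diff_germs n) \<and> derived_length (Diff_germs n\<lparr>carrier := H\<rparr>) < \<infinity>}"

section \<open>Real analytic manifolds and their diffeomorphisms\<close>

text \<open>A chart is a pair of its domain and its coordinate map; the atlas is not required to be
  maximal.\<close>

definition real_analytic_manifold ::
    "nat \<Rightarrow> 'a topology \<Rightarrow> ('a set \<times> ('a \<Rightarrow> nat \<Rightarrow> real)) set \<Rightarrow> bool" where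
  "real_analytic_manifold n M A \<longleftrightarrow>
     Hausdorff_space M \<and> second_countable M \<and>
     (\<Union>(U, x)\<in>A. U) = topspace M \<and>
     (\<forall>(U, x)\<in>A. openin M U \<and> openin (coord_space n) (x ` U) \<and>
        homeomorphic_map (subtopology M U) (subtopology (coord_space n) (x ` U)) x) \<and>
     (\<forall>(U, x)\<in>A. \<forall>(V, y)\<in>A. analytic_map n (x ` (U \<inter> V)) (y \<circ> inv_into U x))"

definition real_analytic_self_map ::
    "nat \<Rightarrow> 'a topology \<Rightarrow> ('a set \<times> ('a \<Rightarrow> nat \<Rightarrow> real)) set \<Rightarrow> ('a \<Rightarrow> 'a) \<Rightarrow> bool" where
  "real_analytic_self_map n M A f \<longleftrightarrow>
     continuous_map M M f \<and>
     (\<forall>(U, x)\<in>A. \<forall>(V, y)\<in>A. analytic_map n (x ` (U \<inter> f -` V)) (y \<circ> f \<circ> inv_into U x))"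

definition real_analytic_diffeo ::
    "nat \<Rightarrow> 'a topology \<Rightarrow> ('a set \<times> ('a \<Rightarrow> nat \<Rightarrow> real)) set \<Rightarrow> ('a \<Rightarrow> 'a) \<Rightarrow> bool" where
  "real_analytic_diffeo n M A f \<longleftrightarrow>
     bij_betw f (topspace M) (topspace M) \<and>
     real_analytic_self_map n M A f \<and>
     real_analytic_self_map n M A (inv_into (topspace M) f)"

end

theory Submission
  imports Defs "HOL-Complex_Analysis.Conformal_Mappings"
begin

text \<open>
  A real analytic germ at \<open>p\<close> that fixes \<open>p\<close> is, in a chart centred at \<open>p\<close>, a convergent power
  series with real coefficients; letting the variables be complex turns it into a germ at
  \<open>0 \<in> \<complex>\<^sup>n\<close>.  Sending \<open>g \<in> G\<close> to this complexification is an injective homomorphism into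
  \<^term>\<open>Diff_germs n\<close>.  Its image is then a solvable subgroup with the same derived length as
  \<open>G\<close>, hence one of the subgroups over which \<^term>\<open>psi n\<close> is the supremum.

  Multiplicativity rests on uniqueness of the complexification: a germ at \<open>0 \<in> \<complex>\<^sup>n\<close> that is
  holomorphic in each variable separately and vanishes at real points vanishes
  (\<open>separately_holomorphic_eq_0\<close>).  The complexification of \<open>g \<circ> h\<close> and the composite of the
  complexifications of \<open>g\<close> and \<open>h\<close> agree at real points, and both are separately holomorphic,
  since substituting holomorphic functions of one variable into a power series gives a uniform
  limit of holomorphic functions (\<open>analytic_along_holomorphic_curve\<close>).  The same uniqueness
  shows that the complexifications of \<open>g\<close> and \<open>g\<^sup>-\<^sup>1\<close> are inverse to each other near \<open>0\<close>; as a
  power series can be expanded again at every point of its polydisc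
  (\<open>expands_on_imp_analytic_fun_at\<close>), they are analytic diffeomorphisms between neighbourhoods
  of \<open>0\<close> (\<open>complexifies_analytic_diffeo\<close>).

  Injectivity is where connectedness enters: an element whose germ at \<open>p\<close> is trivial is the
  identity near \<open>p\<close>, and the set of points near which it is the identity is open and closed
  (\<open>identity_principle_manifold\<close>).
\<close>

section \<open>Polydiscs\<close>

definition polydisc :: "nat \<Rightarrow> (nat \<Rightarrow> 'k::real_normed_field) \<Rightarrow> real \<Rightarrow> (nat \<Rightarrow> 'k) set" where
  "polydisc n a r = {z \<in> topspace (coord_space n). \<forall>i<n. norm (z i - a i) < r}"

lemma topspace_coord_space: "topspace (coord_space n) = {x. \<forall>i\<ge>n. x i = 0}"
  by (simp add: coord_space_def)

lemma polydiscD: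
  assumes "z \<in> polydisc n a r"
  shows "z \<in> topspace (coord_space n)" and "\<And>i. i < n \<Longrightarrow> norm (z i - a i) < r"
  using assms by (auto simp: polydisc_def)

lemma centre_in_polydisc:
  "a \<in> topspace (coord_space n) \<Longrightarrow> r > 0 \<Longrightarrow> a \<in> polydisc n a r"
  by (simp add: polydisc_def)

lemma polydisc_mono: "r \<le> s \<Longrightarrow> polydisc n a r \<subseteq> polydisc n a s"
  by (fastforce simp: polydisc_def)

lemma polydisc_closed_radius:
  assumes "z \<in> polydisc n a r" "r > 0"
  obtains \<rho> where "0 \<le> \<rho>" "\<rho> < r" "\<And>i. i < n \<Longrightarrow> norm (z i - a i) \<le> \<rho>"
proof (rule that)
  let ?\<rho> = "Max (insert 0 ((\<lambda>i. norm (z i - a i)) ` {..<n}))"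
  show "0 \<le> ?\<rho>" "?\<rho> < r" "\<And>i. i < n \<Longrightarrow> norm (z i - a i) \<le> ?\<rho>"
    using polydiscD(2)[OF assms(1)] \<open>r > 0\<close> by auto
qed

lemma openin_polydisc: "openin (coord_space n) (polydisc n a r)"
proof -
  have "open {x :: nat \<Rightarrow> 'a. norm (x i - a i) < r}" for i
    by (intro open_Collect_less continuous_on_norm continuous_on_diff continuous_on_const
          continuous_on_product_coordinates)
  then have "open (\<Inter>i\<in>{..<n}. {x :: nat \<Rightarrow> 'a. norm (x i - a i) < r})"
    by (intro open_INT) auto
  then show ?thesis
    unfolding coord_space_def openin_subtopology euclidean_product_topology open_openin[symmetric]
    by (intro exI[of _ "\<Inter>i\<in>{..<n}. {x. norm (x i - a i) < r}"])
       (auto simp: polydisc_def topspace_coord_space)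
qed

lemma openin_contains_polydisc:
  fixes U :: "(nat \<Rightarrow> 'k::real_normed_field) set"
  assumes "openin (coord_space n) U" "a \<in> U"
  obtains r where "r > 0" "polydisc n a r \<subseteq> U"
proof -
  obtain T where T: "openin (product_topology (\<lambda>_. euclidean) UNIV) T"
      "U = T \<inter> {x. \<forall>i\<ge>n. x i = 0}"
    using assms(1) unfolding coord_space_def openin_subtopology by auto
  obtain X where X: "a \<in> (\<Pi>\<^sub>E i\<in>UNIV. X i)" "\<And>i. open (X i)" "(\<Pi>\<^sub>E i\<in>UNIV. X i) \<subseteq> T"
    using product_topology_open_contains_basis[OF T(1), of a] assms(2) T(2) by auto
  have "\<forall>i. \<exists>e>0. ball (a i) e \<subseteq> X i"
    using X(1,2) open_contains_ball_eq by (metis PiE_E UNIV_I)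
  then obtain e where e: "\<And>i. e i > 0" "\<And>i. ball (a i) (e i) \<subseteq> X i"
    by metis
  define r where "r = Min (insert 1 (e ` {..<n}))"
  have r: "r > 0" "\<And>i. i < n \<Longrightarrow> r \<le> e i"
    using e(1) by (auto simp: r_def)
  have "polydisc n a r \<subseteq> U"
  proof
    fix z assume z: "z \<in> polydisc n a r"
    have "z i \<in> X i" for i
    proof (cases "i < n")
      case True
      then have "norm (z i - a i) < e i"
        using polydiscD(2)[OF z True] r(2)[OF True] by simp
      then show ?thesis
        using e(2)[of i] by (auto simp: dist_norm norm_minus_commute)
    next
      case False
      then have "z i = a i"
        using z assms(2) T(2) by (auto simp: polydisc_def topspace_coord_space)
      then show ?thesis
        using X(1) by auto
    qed
    then show "z \<in> U"
      using X(3) T(2) polydiscD(1)[OF z] by (auto simp: topspace_coord_space)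
  qed
  with r(1) that show thesis by blast
qed

lemma openin_coord_spaceI:
  assumes "U \<subseteq> topspace (coord_space n)" "\<And>a. a \<in> U \<Longrightarrow> \<exists>r>0. polydisc n a r \<subseteq> U"
  shows "openin (coord_space n) U"
proof (subst openin_subopen, intro ballI)
  fix a assume a: "a \<in> U"
  then obtain r where "r > 0" "polydisc n a r \<subseteq> U"
    using assms(2) by blast
  with a assms(1) show "\<exists>T. openin (coord_space n) T \<and> a \<in> T \<and> T \<subseteq> U"
    by (intro exI[of _ "polydisc n a r"]) (auto simp: openin_polydisc intro: centre_in_polydisc)
qed

text \<open>The points of the coordinate space vanish from index \<open>n\<close> on, so the finitely many
  conditions of a polydisc already describe a neighbourhood base.  All germ arguments go through
  this criterion.\<close>

lemma eventually_nhdsin_polydisc: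
  assumes "a \<in> topspace (coord_space n)"
  shows "eventually P (nhdsin (coord_space n) a) \<longleftrightarrow> (\<exists>r>0. \<forall>z\<in>polydisc n a r. P z)"
proof
  assume "eventually P (nhdsin (coord_space n) a)"
  then obtain U where U: "openin (coord_space n) U" "a \<in> U" "\<forall>z\<in>U. P z"
    using assms by (auto simp: eventually_nhdsin)
  obtain r where "r > 0" "polydisc n a r \<subseteq> U"
    using openin_contains_polydisc[OF U(1,2)] .
  with U(3) show "\<exists>r>0. \<forall>z\<in>polydisc n a r. P z"
    by blast
next
  assume "\<exists>r>0. \<forall>z\<in>polydisc n a r. P z"
  then obtain r where "r > 0" "\<forall>z\<in>polydisc n a r. P z"
    by blast
  then show "eventually P (nhdsin (coord_space n) a)"
    unfolding eventually_nhdsin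
    by (intro disjI2 exI[of _ "polydisc n a r"])
       (simp add: openin_polydisc centre_in_polydisc[OF assms])
qed

section \<open>Power series on polydiscs\<close>

text \<open>Radius and coefficients are explicit, because the complexification of a real power series
  and its expansions at other points are built from them.\<close>

definition expands_on ::
    "nat \<Rightarrow> ((nat \<Rightarrow> 'k::real_normed_field) \<Rightarrow> 'k) \<Rightarrow> (nat \<Rightarrow> 'k) \<Rightarrow> real \<Rightarrow>
      ((nat \<Rightarrow> nat) \<Rightarrow> 'k) \<Rightarrow> bool" where
  "expands_on n f a r c \<longleftrightarrow> (\<forall>z\<in>polydisc n a r.
     ((\<lambda>\<alpha>. c \<alpha> * (\<Prod>i<n. (z i - a i) ^ \<alpha> i)) has_sum f z) (multi_indices n))"

lemma analytic_fun_at_iff_expands_on: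
  "analytic_fun_at n f a \<longleftrightarrow> (\<exists>r>0. \<exists>c. expands_on n f a r c)"
  unfolding analytic_fun_at_def expands_on_def polydisc_def by auto

lemma analytic_fun_at_cong:
  assumes "analytic_fun_at n f a" "a \<in> topspace (coord_space n)"
    and "eventually (\<lambda>z. f z = g z) (nhdsin (coord_space n) a)"
  shows "analytic_fun_at n g a"
proof -
  obtain r c where r: "r > 0" "expands_on n f a r c"
    using assms(1) by (auto simp: analytic_fun_at_iff_expands_on)
  obtain s where s: "s > 0" "\<forall>z\<in>polydisc n a s. f z = g z"
    using assms(2,3) by (auto simp: eventually_nhdsin_polydisc)
  have "expands_on n g a (min r s) c"
    using r(2) s(2) polydisc_mono[of "min r s" r n a] polydisc_mono[of "min r s" s n a]
    unfolding expands_on_def by fastforce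
  with r(1) s(1) show ?thesis
    unfolding analytic_fun_at_iff_expands_on by (metis min_less_iff_conj)
qed

text \<open>For complex series unconditional and absolute convergence agree, so convergence at the
  single corner \<open>(\<rho>, \<dots>, \<rho>)\<close> gives one majorant for the whole closed polydisc of radius \<open>\<rho>\<close>.
  Uniform convergence, continuity, holomorphy and the change of centre all come from it.\<close>

lemma corner_majorant:
  fixes c :: "(nat \<Rightarrow> nat) \<Rightarrow> complex"
  assumes "(\<lambda>\<alpha>. c \<alpha> * (\<Prod>i<n. of_real \<rho> ^ \<alpha> i)) summable_on A" "0 \<le> \<rho>"
  shows "(\<lambda>\<alpha>. norm (c \<alpha>) * (\<Prod>i<n. \<rho> ^ \<alpha> i)) summable_on A"
proof -
  have "(\<lambda>\<alpha>. norm (c \<alpha> * (\<Prod>i<n. of_real \<rho> ^ \<alpha> i))) summable_on A"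
    using assms(1) by (rule iffD1[OF summable_on_iff_abs_summable_on_complex])
  moreover have "norm (c \<alpha> * (\<Prod>i<n. of_real \<rho> ^ \<alpha> i)) = norm (c \<alpha>) * (\<Prod>i<n. \<rho> ^ \<alpha> i)" for \<alpha>
    using assms(2) by (simp add: norm_mult norm_power flip: prod_norm)
  ultimately show ?thesis
    by simp
qed

lemma expands_on_corner:
  fixes f :: "(nat \<Rightarrow> 'k::real_normed_field) \<Rightarrow> 'k"
  assumes "expands_on n f a r c" "0 \<le> \<rho>" "\<rho> < r"
  shows "(\<lambda>\<alpha>. c \<alpha> * (\<Prod>i<n. of_real \<rho> ^ \<alpha> i)) summable_on multi_indices n"
proof -
  let ?z = "\<lambda>i. if i < n then a i + of_real \<rho> else 0"
  have "?z \<in> polydisc n a r"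
    using assms(2,3) by (simp add: polydisc_def topspace_coord_space)
  then have "((\<lambda>\<alpha>. c \<alpha> * (\<Prod>i<n. (?z i - a i) ^ \<alpha> i)) has_sum f ?z) (multi_indices n)"
    using assms(1) unfolding expands_on_def by (rule bspec[rotated])
  then show ?thesis
    by (auto dest!: has_sum_imp_summable)
qed

lemma expands_on_majorant:
  fixes f :: "(nat \<Rightarrow> complex) \<Rightarrow> complex"
  assumes "expands_on n f a r c" "0 \<le> \<rho>" "\<rho> < r"
  shows "(\<lambda>\<alpha>. norm (c \<alpha>) * (\<Prod>i<n. \<rho> ^ \<alpha> i)) summable_on multi_indices n"
  using corner_majorant[OF expands_on_corner[OF assms]] assms(2) by simp

lemma norm_monomial_le:
  fixes w :: "nat \<Rightarrow> 'k::real_normed_field"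
  assumes "\<And>i. i < n \<Longrightarrow> norm (w i) \<le> \<rho>"
  shows "norm (c * (\<Prod>i<n. w i ^ \<alpha> i)) \<le> norm c * (\<Prod>i<n. \<rho> ^ \<alpha> i)"
  using assms
  by (auto simp: norm_mult norm_power simp flip: prod_norm
           intro!: mult_left_mono prod_mono power_mono)

lemma expands_on_uniform_limit:
  fixes f :: "(nat \<Rightarrow> complex) \<Rightarrow> complex"
  assumes f: "expands_on n f a r c" and "\<rho> < r"
    and Y: "\<And>t. t \<in> Y \<Longrightarrow> \<gamma> t \<in> topspace (coord_space n)"
      "\<And>t i. t \<in> Y \<Longrightarrow> i < n \<Longrightarrow> norm (\<gamma> t i - a i) \<le> \<rho>" and "0 \<le> \<rho>"
  shows "uniform_limit Y (\<lambda>X t. \<Sum>\<alpha>\<in>X. c \<alpha> * (\<Prod>i<n. (\<gamma> t i - a i) ^ \<alpha> i)) (\<lambda>t. f (\<gamma> t))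
    (finite_subsets_at_top (multi_indices n))"
proof (rule Weierstrass_m_test_general')
  show "norm (c \<alpha> * (\<Prod>i<n. (\<gamma> t i - a i) ^ \<alpha> i)) \<le> norm (c \<alpha>) * (\<Prod>i<n. \<rho> ^ \<alpha> i)"
    if "t \<in> Y" for \<alpha> t
    using Y that by (intro norm_monomial_le) auto
  show "((\<lambda>\<alpha>. c \<alpha> * (\<Prod>i<n. (\<gamma> t i - a i) ^ \<alpha> i)) has_sum f (\<gamma> t)) (multi_indices n)"
    if "t \<in> Y" for t
    using f Y that \<open>\<rho> < r\<close> unfolding expands_on_def polydisc_def by force
qed (rule expands_on_majorant[OF f \<open>0 \<le> \<rho>\<close> \<open>\<rho> < r\<close>])

text \<open>Holomorphy in several variables enters only through curves: along a holomorphic curve the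
  partial sums are polynomials in holomorphic functions, and they converge uniformly on discs.\<close>

lemma analytic_along_holomorphic_curve:
  fixes f :: "(nat \<Rightarrow> complex) \<Rightarrow> complex"
  assumes "analytic_fun_at n f a"
  obtains r where "r > 0" and
    "\<And>S \<gamma>. open S \<Longrightarrow> (\<And>i. i < n \<Longrightarrow> (\<lambda>t. \<gamma> t i) holomorphic_on S) \<Longrightarrow>
      (\<And>t. t \<in> S \<Longrightarrow> \<gamma> t \<in> polydisc n a r) \<Longrightarrow> (\<lambda>t. f (\<gamma> t)) holomorphic_on S"
proof -
  obtain r c where r: "r > 0" and f: "expands_on n f a r c"
    using assms by (auto simp: analytic_fun_at_iff_expands_on)
  show thesis
  proof (rule that[of "r/2"])
    fix S :: "complex set" and \<gamma> :: "complex \<Rightarrow> nat \<Rightarrow> complex"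
    assume S: "open S" and hol: "\<And>i. i < n \<Longrightarrow> (\<lambda>t. \<gamma> t i) holomorphic_on S"
      and mem: "\<And>t. t \<in> S \<Longrightarrow> \<gamma> t \<in> polydisc n a (r/2)"
    have "\<exists>g'. ((\<lambda>t. f (\<gamma> t)) has_field_derivative g') (at t)" if t: "t \<in> S" for t
    proof -
      obtain d where d: "d > 0" "cball t d \<subseteq> S"
        using S t open_contains_cball by blast
      have lim: "uniform_limit (cball t d)
          (\<lambda>X t. \<Sum>\<alpha>\<in>X. c \<alpha> * (\<Prod>i<n. (\<gamma> t i - a i) ^ \<alpha> i)) (\<lambda>t. f (\<gamma> t))
          (finite_subsets_at_top (multi_indices n))"
        using d(2) r
        by (intro expands_on_uniform_limit[OF f, of "r/2"])
           (use polydiscD[OF mem] d(2) in \<open>auto intro: less_imp_le simp: subset_iff\<close>)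
      have part: "(\<lambda>t. \<Sum>\<alpha>\<in>X. c \<alpha> * (\<Prod>i<n. (\<gamma> t i - a i) ^ \<alpha> i)) holomorphic_on cball t d" for X
        using holomorphic_on_subset[OF hol d(2)] by (auto intro!: holomorphic_intros)
      obtain "(\<lambda>t. f (\<gamma> t)) holomorphic_on ball t d"
        by (rule holomorphic_uniform_limit[OF _ lim])
           (auto intro!: always_eventually holomorphic_on_imp_continuous_on part
             holomorphic_on_subset[OF part])
      then show ?thesis
        using d(1) holomorphic_on_imp_differentiable_at[of _ "ball t d" t]
        by (auto simp: field_differentiable_def)
    qed
    then show "(\<lambda>t. f (\<gamma> t)) holomorphic_on S"
      by (auto simp: holomorphic_on_def field_differentiable_def
               intro: has_field_derivative_at_within)
  qed (use r in simp)
qed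

lemma analytic_fun_at_continuous:
  fixes f :: "(nat \<Rightarrow> complex) \<Rightarrow> complex"
  assumes "analytic_fun_at n f a" and a: "a \<in> topspace (coord_space n)" and "e > 0"
  shows "\<exists>r>0. \<forall>z\<in>polydisc n a r. norm (f z - f a) < e"
proof -
  obtain r c where r: "r > 0" and f: "expands_on n f a r c"
    using assms by (auto simp: analytic_fun_at_iff_expands_on)
  have lim: "uniform_limit (polydisc n a (r/2))
      (\<lambda>X z. \<Sum>\<alpha>\<in>X. c \<alpha> * (\<Prod>i<n. (z i - a i) ^ \<alpha> i)) f
      (finite_subsets_at_top (multi_indices n))"
    using r by (intro expands_on_uniform_limit[OF f, of "r/2" _ "\<lambda>z. z"])
      (auto dest: polydiscD intro: less_imp_le)
  have "continuous_on (polydisc n a (r/2)) f"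
    by (rule uniform_limit_theorem[OF _ lim])
       (auto intro!: always_eventually continuous_intros
             intro: continuous_on_subset[OF continuous_on_product_coordinates])
  moreover have "a \<in> polydisc n a (r/2)"
    using a r by (simp add: centre_in_polydisc)
  ultimately have "\<exists>T. open T \<and> a \<in> T \<and> (\<forall>z\<in>polydisc n a (r/2) \<inter> T. f z \<in> ball (f a) e)"
    unfolding continuous_on_topological using \<open>e > 0\<close>
    by (metis IntD1 IntD2 centre_in_ball open_ball)
  then obtain T where T: "open T" "a \<in> T" "\<And>z. z \<in> polydisc n a (r/2) \<Longrightarrow> z \<in> T \<Longrightarrow> f z \<in> ball (f a) e"
    by blast
  have "openin (coord_space n) (topspace (coord_space n) \<inter> T)"
    using T(1) unfolding coord_space_def openin_subtopology euclidean_product_topology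
      open_openin[symmetric] by auto
  then obtain s where s: "s > 0" "polydisc n a s \<subseteq> topspace (coord_space n) \<inter> T"
    using openin_contains_polydisc a T(2) by blast
  show ?thesis
  proof (intro exI conjI ballI)
    fix z assume "z \<in> polydisc n a (min s (r/2))"
    then have "f z \<in> ball (f a) e"
      using T(3)[of z] s(2) polydisc_mono[of "min s (r/2)" s n a]
        polydisc_mono[of "min s (r/2)" "r/2" n a] min.cobounded1 min.cobounded2
      by blast
    then show "norm (f z - f a) < e"
      by (simp add: dist_norm norm_minus_commute)
  qed (use r s in simp)
qed

text \<open>The binomial theorem in each of \<open>n\<close> variables.  The sum can range over all multi-indices,
  since a binomial coefficient vanishes as soon as \<open>\<beta>\<close> exceeds \<open>\<alpha>\<close> in some variable; an index set
  that does not depend on \<open>\<alpha>\<close> makes the interchange of summations below a swap of a product.\<close>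

lemma has_sum_prod_binomials:
  fixes b w :: "nat \<Rightarrow> 'k::real_normed_field"
  shows "((\<lambda>\<beta>. \<Prod>i<n. of_nat (\<alpha> i choose \<beta> i) * b i ^ (\<alpha> i - \<beta> i) * w i ^ \<beta> i) has_sum
    (\<Prod>i<n. (b i + w i) ^ \<alpha> i)) (multi_indices n)"
proof (rule has_sum_finite_neutralI)
  let ?B = "{\<beta> \<in> multi_indices n. \<forall>i<n. \<beta> i \<le> \<alpha> i}"
  let ?P = "PiE {..<n} (\<lambda>i. {..\<alpha> i})"
  let ?t = "\<lambda>i k. of_nat (\<alpha> i choose k) * b i ^ (\<alpha> i - k) * w i ^ k"
  have bij: "bij_betw (\<lambda>g i. if i < n then g i else 0) ?P ?B"
    by (rule bij_betwI[of _ _ _ "\<lambda>\<beta>. restrict \<beta> {..<n}"])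
       (auto simp: multi_indices_def PiE_def Pi_def extensional_def fun_eq_iff restrict_def)
  show "finite ?B"
    using bij_betw_finite[OF bij] by (simp add: finite_PiE)
  show "?B \<subseteq> multi_indices n"
    by auto
  show "(\<Prod>i<n. ?t i (\<beta> i)) = 0" if "\<beta> \<in> multi_indices n - ?B" for \<beta>
  proof -
    obtain i where "i < n" "\<alpha> i < \<beta> i"
      using \<open>\<beta> \<in> _\<close> by (auto simp: not_le)
    then show ?thesis
      by (intro prod_zero) (auto simp: binomial_eq_0 intro!: bexI[of _ i])
  qed
  have "(\<Prod>i<n. (b i + w i) ^ \<alpha> i) = (\<Prod>i<n. \<Sum>k\<le>\<alpha> i. ?t i k)"
    by (intro prod.cong refl) (subst add.commute, subst binomial_ring, simp add: mult_ac)
  also have "\<dots> = (\<Sum>g\<in>?P. \<Prod>i<n. ?t i (g i))"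
    by (rule prod_sum_PiE) auto
  also have "\<dots> = (\<Sum>\<beta>\<in>?B. \<Prod>i<n. ?t i (\<beta> i))"
    by (subst sum.reindex_bij_betw[OF bij, symmetric]) (auto intro!: sum.cong prod.cong)
  finally show "(\<Prod>i<n. (b i + w i) ^ \<alpha> i) = (\<Sum>\<beta>\<in>?B. \<Prod>i<n. ?t i (\<beta> i))" .
qed

text \<open>Change of centre: expand \<open>(z - a)\<^sup>\<alpha> = ((b - a) + (z - b))\<^sup>\<alpha>\<close> by the binomial theorem and
  collect the powers of \<open>z - b\<close>.  The interchange is justified by absolute convergence of the
  double series, whose \<open>\<alpha>\<close>-th row has absolute sum
  \<open>\<bar>c\<^sub>\<alpha>\<bar> \<Prod>\<^sub>i (\<bar>b\<^sub>i - a\<^sub>i\<bar> + \<bar>z\<^sub>i - b\<^sub>i\<bar>)\<^sup>\<alpha>\<^sup>i\<close> and is thus dominated by the majorant on a slightly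
  smaller polydisc.\<close>

lemma expands_on_imp_analytic_fun_at:
  fixes f :: "(nat \<Rightarrow> complex) \<Rightarrow> complex"
  assumes f: "expands_on n f a r c" and "r > 0" and b: "b \<in> polydisc n a r"
  shows "analytic_fun_at n f b"
proof -
  obtain \<mu> where \<mu>: "0 \<le> \<mu>" "\<mu> < r" "\<And>i. i < n \<Longrightarrow> norm (b i - a i) \<le> \<mu>"
    using polydisc_closed_radius[OF b \<open>r > 0\<close>] by blast
  define \<rho> where "\<rho> = (\<mu> + r) / 2"
  have \<rho>: "0 \<le> \<rho>" "\<mu> < \<rho>" "\<rho> < r"
    using \<mu> by (auto simp: \<rho>_def)
  define x where
    "x \<beta> \<alpha> = c \<alpha> * (\<Prod>i<n. of_nat (\<alpha> i choose \<beta> i) * (b i - a i) ^ (\<alpha> i - \<beta> i))" for \<alpha> \<beta>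
  have "expands_on n f b (\<rho> - \<mu>) (\<lambda>\<beta>. infsum (x \<beta>) (multi_indices n))"
    unfolding expands_on_def
  proof
    fix z assume z: "z \<in> polydisc n b (\<rho> - \<mu>)"
    define w where "w i = z i - b i" for i
    let ?M = "multi_indices n"
    let ?w = "\<lambda>\<beta>. \<Prod>i<n. w i ^ \<beta> i"
    let ?t = "\<lambda>(\<alpha>, \<beta>). x \<beta> \<alpha> * ?w \<beta>"
    have le: "norm (b i - a i) + norm (w i) \<le> \<rho>" if "i < n" for i
      using polydiscD(2)[OF z that] \<mu>(3)[OF that] by (simp add: w_def)
    have za: "z i - a i = (b i - a i) + w i" for i
      by (simp add: w_def)
    have "norm (z i - a i) < r" if "i < n" for i
      unfolding za using norm_triangle_ineq[of "b i - a i" "w i"] le[OF that] \<rho>(3) by linarith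
    then have zr: "z \<in> polydisc n a r"
      using polydiscD(1)[OF z] by (simp add: polydisc_def)
    have t_eq: "?t (\<alpha>, \<beta>) =
        c \<alpha> * (\<Prod>i<n. of_nat (\<alpha> i choose \<beta> i) * (b i - a i) ^ (\<alpha> i - \<beta> i) * w i ^ \<beta> i)" for \<alpha> \<beta>
      by (simp add: x_def prod.distrib mult_ac)
    have "(\<lambda>p. norm (?t p)) summable_on ?M \<times> ?M"
    proof (rule summable_on_SigmaI)
      show "((\<lambda>\<beta>. norm (?t (\<alpha>, \<beta>))) has_sum
          norm (c \<alpha>) * (\<Prod>i<n. (norm (b i - a i) + norm (w i)) ^ \<alpha> i)) ?M" for \<alpha>
        unfolding t_eq norm_mult prod_norm[symmetric] norm_power norm_of_nat
        by (intro has_sum_cmult_right has_sum_prod_binomials)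
      show "(\<lambda>\<alpha>. norm (c \<alpha>) * (\<Prod>i<n. (norm (b i - a i) + norm (w i)) ^ \<alpha> i)) summable_on ?M"
      proof (rule summable_on_comparison_test)
        show "(\<lambda>\<alpha>. norm (c \<alpha>) * (\<Prod>i<n. \<rho> ^ \<alpha> i)) summable_on ?M"
          by (rule expands_on_majorant[OF f \<rho>(1,3)])
      qed (auto intro!: mult_left_mono prod_mono power_mono le mult_nonneg_nonneg prod_nonneg)
    qed simp
    then have "?t summable_on ?M \<times> ?M"
      by (rule abs_summable_summable)
    then obtain s where s: "(?t has_sum s) (?M \<times> ?M)"
      by (auto simp: summable_on_def)
    have inner: "((\<lambda>\<beta>. ?t (\<alpha>, \<beta>)) has_sum c \<alpha> * (\<Prod>i<n. (z i - a i) ^ \<alpha> i)) ?M" for \<alpha>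
      unfolding t_eq za by (intro has_sum_cmult_right has_sum_prod_binomials)
    have "((\<lambda>\<alpha>. c \<alpha> * (\<Prod>i<n. (z i - a i) ^ \<alpha> i)) has_sum s) ?M"
      using has_sum_SigmaD[OF s inner] .
    moreover have "((\<lambda>\<alpha>. c \<alpha> * (\<Prod>i<n. (z i - a i) ^ \<alpha> i)) has_sum f z) ?M"
      using f zr unfolding expands_on_def by (rule bspec)
    ultimately have "s = f z"
      by (rule has_sum_unique)
    then have swapped: "((\<lambda>(\<beta>, \<alpha>). x \<beta> \<alpha> * ?w \<beta>) has_sum f z) (?M \<times> ?M)"
      using s by (subst (asm) has_sum_swap) (simp add: case_prod_unfold)
    have "((\<lambda>\<beta>. infsum (x \<beta>) ?M * ?w \<beta>) has_sum f z) ?M"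
    proof (rule has_sum_SigmaD[OF swapped])
      fix \<beta> assume "\<beta> \<in> ?M"
      have sum: "(\<lambda>\<alpha>. x \<beta> \<alpha> * ?w \<beta>) summable_on ?M"
        using summable_on_SigmaD1[OF has_sum_imp_summable[OF swapped] \<open>\<beta> \<in> ?M\<close>] .
      show "((\<lambda>\<alpha>. case (\<beta>, \<alpha>) of (\<beta>, \<alpha>) \<Rightarrow> x \<beta> \<alpha> * ?w \<beta>) has_sum infsum (x \<beta>) ?M * ?w \<beta>) ?M"
      \<comment> \<open>Summability of \<open>x \<beta>\<close> can be read off from the row only where the monomial is nonzero;
        where it is zero both sides are.\<close>
      proof (cases "?w \<beta> = 0")
        case False
        then have "x \<beta> summable_on ?M"
          using sum by (subst (asm) summable_on_cmult_left') auto
        then show ?thesis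
          by (auto intro!: has_sum_cmult_left)
      next
        case True
        show ?thesis
          unfolding prod.case True by simp
      qed
    qed
    then show "((\<lambda>\<beta>. infsum (x \<beta>) ?M * (\<Prod>i<n. (z i - b i) ^ \<beta> i)) has_sum f z) ?M"
      by (simp add: w_def)
  qed
  then show ?thesis
    using \<rho>(2) unfolding analytic_fun_at_iff_expands_on by (metis diff_gt_0_iff_gt)
qed

lemma eventually_analytic_fun_at:
  fixes f :: "(nat \<Rightarrow> complex) \<Rightarrow> complex"
  assumes "analytic_fun_at n f a" "a \<in> topspace (coord_space n)"
  shows "eventually (\<lambda>b. analytic_fun_at n f b) (nhdsin (coord_space n) a)"
  using assms expands_on_imp_analytic_fun_at
  unfolding eventually_nhdsin_polydisc[OF assms(2)] analytic_fun_at_iff_expands_on[of n f a]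
  by blast

section \<open>Complex germs are determined by their values at real points\<close>

text \<open>Unlike the existence of a power series, this property visibly passes from analytic maps to
  their composites, and it is strong enough for the uniqueness theorem.\<close>

definition separately_holomorphic :: "nat \<Rightarrow> ((nat \<Rightarrow> complex) \<Rightarrow> complex) \<Rightarrow> bool" where
  "separately_holomorphic n f \<longleftrightarrow>
     (\<exists>r>0. \<forall>z\<in>polydisc n origin r. \<forall>j<n. (\<lambda>t. f (z(j := t))) holomorphic_on ball 0 r)"

lemma origin_in_coord_space [simp]: "(\<lambda>_. 0) \<in> topspace (coord_space n)"
  by (simp add: topspace_coord_space)

lemma polydisc_fun_upd:
  assumes "z \<in> polydisc n (\<lambda>_. 0) r" "j < n" "norm t < r"
  shows "z(j := t) \<in> polydisc n (\<lambda>_. 0) r"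
  using assms by (auto simp: polydisc_def topspace_coord_space)

lemma separately_holomorphicI:
  assumes "r > 0"
    and "\<And>S \<gamma>. open S \<Longrightarrow> (\<And>i. i < n \<Longrightarrow> (\<lambda>t. \<gamma> t i) holomorphic_on S) \<Longrightarrow>
      (\<And>t. t \<in> S \<Longrightarrow> \<gamma> t \<in> polydisc n origin r) \<Longrightarrow> (\<lambda>t. f (\<gamma> t)) holomorphic_on S"
  shows "separately_holomorphic n f"
  unfolding separately_holomorphic_def
proof (intro exI conjI ballI allI impI)
  fix z j assume z: "z \<in> polydisc n origin r" "j < n"
  show "(\<lambda>t. f (z(j := t))) holomorphic_on ball 0 r"
  proof (rule assms(2))
    show "(\<lambda>t. (z(j := t)) i) holomorphic_on ball 0 r" for i
      by (cases "i = j") auto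
  qed (use z in \<open>auto intro: polydisc_fun_upd\<close>)
qed (fact assms(1))

lemma separately_holomorphic_diff:
  assumes "separately_holomorphic n f" "separately_holomorphic n g"
  shows "separately_holomorphic n (\<lambda>z. f z - g z)"
proof -
  obtain r where r: "r > 0"
    "\<And>z j. z \<in> polydisc n origin r \<Longrightarrow> j < n \<Longrightarrow> (\<lambda>t. f (z(j := t))) holomorphic_on ball 0 r"
    using assms(1) by (auto simp: separately_holomorphic_def)
  obtain s where s: "s > 0"
    "\<And>z j. z \<in> polydisc n origin s \<Longrightarrow> j < n \<Longrightarrow> (\<lambda>t. g (z(j := t))) holomorphic_on ball 0 s"
    using assms(2) by (auto simp: separately_holomorphic_def)
  show ?thesis
    unfolding separately_holomorphic_def
  proof (intro exI[of _ "min r s"] conjI ballI allI impI)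
    fix z j assume z: "z \<in> polydisc n origin (min r s)" and j: "j < n"
    have "z \<in> polydisc n origin r" "z \<in> polydisc n origin s"
      using z polydisc_mono[of "min r s" r n origin] polydisc_mono[of "min r s" s n origin] by auto
    then show "(\<lambda>t. f (z(j := t)) - g (z(j := t))) holomorphic_on ball 0 (min r s)"
      by (intro holomorphic_on_diff holomorphic_on_subset[OF r(2)[OF _ j]]
            holomorphic_on_subset[OF s(2)[OF _ j]]) auto
  qed (use r s in simp)
qed

lemma separately_holomorphic_coordinate: "i < n \<Longrightarrow> separately_holomorphic n (\<lambda>z. z i)"
  by (rule separately_holomorphicI[of 1]) auto

lemma analytic_imp_separately_holomorphic:
  assumes "analytic_fun_at n f origin"
  shows "separately_holomorphic n f"
proof -
  obtain r where "r > 0" and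
    "\<And>S \<gamma>. open S \<Longrightarrow> (\<And>i. i < n \<Longrightarrow> (\<lambda>t. \<gamma> t i) holomorphic_on S) \<Longrightarrow>
      (\<And>t. t \<in> S \<Longrightarrow> \<gamma> t \<in> polydisc n origin r) \<Longrightarrow> (\<lambda>t. f (\<gamma> t)) holomorphic_on S"
    using analytic_along_holomorphic_curve[OF assms] by metis
  then show ?thesis
    by (rule separately_holomorphicI)
qed

lemma zero_islimpt_Reals:
  assumes "e > 0"
  shows "(0::complex) islimpt (\<real> \<inter> ball 0 e)"
proof (unfold islimpt_approachable, intro allI impI)
  fix d :: real assume "d > 0"
  with assms show "\<exists>x'\<in>\<real> \<inter> ball 0 e. x' \<noteq> 0 \<and> dist x' (0::complex) < d"
    by (intro bexI[of _ "of_real (min d e / 2)"]) auto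
qed

text \<open>The variables are freed from the real axis one after the other: if \<open>f\<close> vanishes whenever the
  variables from \<open>k\<close> on are real, then as a holomorphic function of the \<open>k\<close>-th variable alone it
  vanishes on a real interval, hence identically.\<close>

lemma separately_holomorphic_eq_0:
  assumes "separately_holomorphic n f"
    and "eventually (\<lambda>y. f (of_real \<circ> y) = 0) (nhdsin (coord_space n) (\<lambda>_. 0 :: real))"
  shows "eventually (\<lambda>z. f z = 0) (nhdsin (coord_space n) origin)"
proof -
  obtain r where r: "r > 0"
    "\<And>z j. z \<in> polydisc n origin r \<Longrightarrow> j < n \<Longrightarrow> (\<lambda>t. f (z(j := t))) holomorphic_on ball 0 r"
    using assms(1) by (auto simp: separately_holomorphic_def)
  obtain s where s: "s > 0" "\<And>y :: nat \<Rightarrow> real. y \<in> polydisc n (\<lambda>_. 0) s \<Longrightarrow> f (of_real \<circ> y) = 0"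
    using assms(2) by (auto simp: eventually_nhdsin_polydisc)
  define e where "e = min r s"
  have e: "e > 0" "e \<le> r" "e \<le> s"
    using r(1) s(1) by (auto simp: e_def)
  have vanish: "f z = 0"
    if "k \<le> n" "z \<in> polydisc n origin e" "\<forall>i\<ge>k. z i \<in> \<real>" for k z
    using that
  proof (induction k arbitrary: z)
    case 0
    let ?y = "\<lambda>i. Re (z i)"
    have z: "of_real \<circ> ?y = z"
      using 0 by (auto simp: fun_eq_iff complex_is_Real_iff complex_eq_iff)
    have "norm (?y i) = norm (z i)" for i
      by (subst z[symmetric]) simp
    then have "?y \<in> polydisc n (\<lambda>_. 0) s"
      using polydiscD[OF 0(2)] e(3) by (force simp: polydisc_def topspace_coord_space)
    then show ?case
      using s(2) z by metis
  next
    case (Suc k)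
    let ?g = "\<lambda>t. f (z(k := t))"
    have z: "z \<in> polydisc n origin r"
      using Suc.prems(2) e(2) polydisc_mono by blast
    have "?g (z k) = 0"
    proof (rule analytic_continuation[of ?g "ball 0 e" "\<real> \<inter> ball 0 e" 0])
      show "?g holomorphic_on ball 0 e"
        using r(2)[OF z, of k] Suc.prems(1) e(2) by (auto intro: holomorphic_on_subset)
      show "(0::complex) islimpt (\<real> \<inter> ball 0 e)"
        by (rule zero_islimpt_Reals[OF e(1)])
      show "?g t = 0" if "t \<in> \<real> \<inter> ball 0 e" for t
        using Suc.prems that by (intro Suc.IH polydisc_fun_upd) (auto simp: Suc_le_eq)
    qed (use e polydiscD(2)[OF Suc.prems(2)] Suc.prems(1) in auto)
    then show ?case
      by simp
  qed
  have "f z = 0" if "z \<in> polydisc n origin e" for z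
    using that polydiscD(1)[OF that] by (intro vanish[of n]) (auto simp: topspace_coord_space)
  then show ?thesis
    using e(1) by (auto simp: eventually_nhdsin_polydisc)
qed

lemma separately_holomorphic_eq:
  assumes "separately_holomorphic n f" "separately_holomorphic n g"
    and "eventually (\<lambda>y. f (of_real \<circ> y) = g (of_real \<circ> y)) (nhdsin (coord_space n) (\<lambda>_. 0 :: real))"
  shows "eventually (\<lambda>z. f z = g z) (nhdsin (coord_space n) origin)"
  using separately_holomorphic_eq_0[OF separately_holomorphic_diff[OF assms(1,2)]] assms(3) by simp

section \<open>Complexification of real analytic germs\<close>

text \<open>The real series converges absolutely on each smaller polydisc, and absolute convergence
  depends on the moduli of the variables only, so it survives the passage to complex ones.\<close>

lemma expands_on_complexification:
  fixes f :: "(nat \<Rightarrow> real) \<Rightarrow> real"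
  assumes f: "expands_on n f a r c" and "r > 0"
  defines "fc \<equiv> \<lambda>z. \<Sum>\<^sub>\<infinity>\<alpha>\<in>multi_indices n. of_real (c \<alpha>) * (\<Prod>i<n. (z i - (of_real \<circ> a) i) ^ \<alpha> i)"
  shows "expands_on n fc (of_real \<circ> a) r (\<lambda>\<alpha>. complex_of_real (c \<alpha>))"
    and "y \<in> polydisc n a r \<Longrightarrow> fc (of_real \<circ> y) = complex_of_real (f y)"
proof -
  show "expands_on n fc (of_real \<circ> a) r (\<lambda>\<alpha>. complex_of_real (c \<alpha>))"
    unfolding expands_on_def
  proof
    fix z :: "nat \<Rightarrow> complex" assume z: "z \<in> polydisc n (of_real \<circ> a) r"
    obtain \<rho> where \<rho>: "0 \<le> \<rho>" "\<rho> < r" "\<And>i. i < n \<Longrightarrow> norm (z i - (of_real \<circ> a) i) \<le> \<rho>"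
      using polydisc_closed_radius[OF z \<open>r > 0\<close>] by blast
    have "(\<lambda>\<alpha>. complex_of_real (c \<alpha> * (\<Prod>i<n. \<rho> ^ \<alpha> i))) summable_on multi_indices n"
      using expands_on_corner[OF f \<rho>(1,2)] by (intro summable_on_of_real) simp
    then have "(\<lambda>\<alpha>. norm (complex_of_real (c \<alpha>)) * (\<Prod>i<n. \<rho> ^ \<alpha> i)) summable_on multi_indices n"
      using \<rho>(1) by (intro corner_majorant) simp_all
    then have "(\<lambda>\<alpha>. norm (of_real (c \<alpha>) * (\<Prod>i<n. (z i - (of_real \<circ> a) i) ^ \<alpha> i)))
        summable_on multi_indices n"
      by (rule Infinite_Sum.abs_summable_on_comparison_test') (rule norm_monomial_le, rule \<rho>(3))
    then show "((\<lambda>\<alpha>. of_real (c \<alpha>) * (\<Prod>i<n. (z i - (of_real \<circ> a) i) ^ \<alpha> i)) has_sum fc z)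
        (multi_indices n)"
      unfolding fc_def by (intro has_sum_infsum) (rule abs_summable_summable)
  qed
next
  assume "y \<in> polydisc n a r"
  then have "((\<lambda>\<alpha>. c \<alpha> * (\<Prod>i<n. (y i - a i) ^ \<alpha> i)) has_sum f y) (multi_indices n)"
    using f unfolding expands_on_def by (rule bspec[rotated])
  then have "((\<lambda>\<alpha>. complex_of_real (c \<alpha> * (\<Prod>i<n. (y i - a i) ^ \<alpha> i))) has_sum of_real (f y))
      (multi_indices n)"
    by (rule has_sum_of_real)
  then show "fc (of_real \<circ> y) = complex_of_real (f y)"
    unfolding fc_def by (intro infsumI) simp
qed

lemma real_analytic_extends:
  fixes f :: "(nat \<Rightarrow> real) \<Rightarrow> real"
  assumes "analytic_fun_at n f a"
  obtains fc r where "r > 0" "analytic_fun_at n fc (of_real \<circ> a)"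
    "\<And>y. y \<in> polydisc n a r \<Longrightarrow> fc (of_real \<circ> y) = complex_of_real (f y)"
proof -
  obtain r c where r: "r > 0" "expands_on n f a r c"
    using assms by (auto simp: analytic_fun_at_iff_expands_on)
  show thesis
    using r(1) expands_on_complexification[OF r(2,1)]
    by (intro that[OF r(1)]) (auto simp: analytic_fun_at_iff_expands_on)
qed

text \<open>A relation rather than a function of \<open>\<phi>\<close>, since only germs matter.  Coordinates from \<open>n\<close> on
  are controlled by requiring that \<open>F\<close> preserves the coordinate space.\<close>

definition complexifies ::
    "nat \<Rightarrow> ((nat \<Rightarrow> real) \<Rightarrow> nat \<Rightarrow> real) \<Rightarrow> ((nat \<Rightarrow> complex) \<Rightarrow> nat \<Rightarrow> complex) \<Rightarrow> bool" where
  "complexifies n \<phi> F \<longleftrightarrow>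
     F \<in> topspace (coord_space n) \<rightarrow> topspace (coord_space n) \<and> F origin = origin \<and>
     (\<forall>i<n. analytic_fun_at n (\<lambda>z. F z i) origin) \<and>
     eventually (\<lambda>y. F (of_real \<circ> y) = of_real \<circ> \<phi> y) (nhdsin (coord_space n) (\<lambda>_. 0))"

lemma eventually_nhdsin_imp_at:
  "eventually P (nhdsin X a) \<Longrightarrow> a \<in> topspace X \<Longrightarrow> P a"
  by (auto simp: eventually_nhdsin)

lemma eventually_in_topspace: "eventually (\<lambda>z. z \<in> topspace X) (nhdsin X a)"
  unfolding eventually_nhdsin by (meson openin_topspace)

lemma eventually_in_open: "openin X U \<Longrightarrow> a \<in> U \<Longrightarrow> eventually (\<lambda>z. z \<in> U) (nhdsin X a)"
  unfolding eventually_nhdsin by blast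

lemma of_real_comp_in_polydisc_iff:
  "(of_real \<circ> y :: nat \<Rightarrow> 'k::real_normed_field) \<in> polydisc n (\<lambda>_. 0) r \<longleftrightarrow> y \<in> polydisc n (\<lambda>_. 0) r"
  by (auto simp: polydisc_def topspace_coord_space)

lemma of_real_comp_tendsto_origin:
  "filterlim (\<lambda>y. of_real \<circ> y) (nhdsin (coord_space n) origin) (nhdsin (coord_space n) (\<lambda>_. 0))"
  unfolding filterlim_iff
  by (auto simp: eventually_nhdsin_polydisc of_real_comp_in_polydisc_iff)

lemma ex_complexification:
  assumes "\<And>i. i < n \<Longrightarrow> analytic_fun_at n (\<lambda>y. \<phi> y i) (\<lambda>_. 0)"
    and "\<phi> (\<lambda>_. 0) = (\<lambda>_. 0)"
    and "eventually (\<lambda>y. \<phi> y \<in> topspace (coord_space n)) (nhdsin (coord_space n) (\<lambda>_. 0))"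
  shows "\<exists>F. complexifies n \<phi> F"
proof -
  have "\<exists>g r. r > 0 \<and> analytic_fun_at n g origin \<and>
      (\<forall>y\<in>polydisc n (\<lambda>_. 0) r. g (of_real \<circ> y) = complex_of_real (\<phi> y i))" if i: "i < n" for i
  proof -
    obtain g r where "r > 0" "analytic_fun_at n g (of_real \<circ> (\<lambda>_. 0))"
      "\<And>y. y \<in> polydisc n (\<lambda>_. 0) r \<Longrightarrow> g (of_real \<circ> y) = complex_of_real (\<phi> y i)"
      using real_analytic_extends[OF assms(1)[OF i]] by metis
    then show ?thesis
      by (auto simp: comp_def)
  qed
  then obtain g r where g: "\<And>i. i < n \<Longrightarrow> r i > 0" "\<And>i. i < n \<Longrightarrow> analytic_fun_at n (g i) origin"
    "\<And>i y. i < n \<Longrightarrow> y \<in> polydisc n (\<lambda>_. 0) (r i) \<Longrightarrow> g i (of_real \<circ> y) = complex_of_real (\<phi> y i)"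
    by metis
  define F where "F z i = (if i < n then g i z else 0)" for z i
  have "eventually (\<lambda>y. g i (of_real \<circ> y) = complex_of_real (\<phi> y i)) (nhdsin (coord_space n) (\<lambda>_. 0))"
    if "i < n" for i
    using g(1,3)[OF that] by (auto simp: eventually_nhdsin_polydisc)
  then have "eventually (\<lambda>y. \<forall>i\<in>{..<n}. g i (of_real \<circ> y) = complex_of_real (\<phi> y i))
      (nhdsin (coord_space n) (\<lambda>_. 0))"
    by (intro eventually_ball_finite) auto
  then have ev: "eventually (\<lambda>y. F (of_real \<circ> y) = of_real \<circ> \<phi> y) (nhdsin (coord_space n) (\<lambda>_. 0))"
    using assms(3) by eventually_elim (auto simp: F_def fun_eq_iff topspace_coord_space)
  have "F (of_real \<circ> (\<lambda>_. 0)) = of_real \<circ> \<phi> (\<lambda>_. 0)"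
    by (rule eventually_nhdsin_imp_at[OF ev]) simp
  then have "F origin = origin"
    by (simp add: assms(2) comp_def)
  with ev g(2) show ?thesis
    by (intro exI[of _ F]) (auto simp: complexifies_def F_def topspace_coord_space)
qed

lemma analytic_map_tendsto:
  fixes F :: "(nat \<Rightarrow> complex) \<Rightarrow> nat \<Rightarrow> complex"
  assumes "\<And>i. i < n \<Longrightarrow> analytic_fun_at n (\<lambda>z. F z i) a" "a \<in> topspace (coord_space n)"
    and "eventually (\<lambda>z. F z \<in> topspace (coord_space n)) (nhdsin (coord_space n) a)"
  shows "filterlim F (nhdsin (coord_space n) (F a)) (nhdsin (coord_space n) a)"
  unfolding filterlim_iff
proof (intro allI impI)
  fix P assume P: "eventually P (nhdsin (coord_space n) (F a))"
  have "F a \<in> topspace (coord_space n)"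
    by (rule eventually_nhdsin_imp_at[OF assms(3,2)])
  then obtain e where e: "e > 0" "\<forall>z\<in>polydisc n (F a) e. P z"
    using P by (auto simp: eventually_nhdsin_polydisc)
  have "eventually (\<lambda>z. \<forall>i\<in>{..<n}. norm (F z i - F a i) < e) (nhdsin (coord_space n) a)"
    using analytic_fun_at_continuous[OF assms(1,2) e(1)] assms(2)
    by (intro eventually_ball_finite) (auto simp: eventually_nhdsin_polydisc)
  then show "eventually (\<lambda>z. P (F z)) (nhdsin (coord_space n) a)"
    using assms(3) by eventually_elim (use e(2) in \<open>auto simp: polydisc_def\<close>)
qed

text \<open>Along a coordinate line near the origin, the components of \<open>H\<close> form a holomorphic curve, and
  \<open>f\<close> is holomorphic along that curve.\<close>

lemma analytic_compose_separately_holomorphic: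
  assumes f: "analytic_fun_at n f origin"
    and H: "\<And>i. i < n \<Longrightarrow> analytic_fun_at n (\<lambda>z. H z i) origin"
    and lim: "filterlim H (nhdsin (coord_space n) origin) (nhdsin (coord_space n) origin)"
  shows "separately_holomorphic n (\<lambda>z. f (H z))"
proof -
  obtain r where r: "r > 0" and f_hol:
    "\<And>S \<gamma>. open S \<Longrightarrow> (\<And>i. i < n \<Longrightarrow> (\<lambda>t. \<gamma> t i) holomorphic_on S) \<Longrightarrow>
      (\<And>t. t \<in> S \<Longrightarrow> \<gamma> t \<in> polydisc n origin r) \<Longrightarrow> (\<lambda>t. f (\<gamma> t)) holomorphic_on S"
    using analytic_along_holomorphic_curve[OF f] by metis
  have "eventually (\<lambda>z. z \<in> polydisc n origin r) (nhdsin (coord_space n) origin)"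
    using r by (auto simp: eventually_nhdsin_polydisc)
  then have "eventually (\<lambda>z. H z \<in> polydisc n origin r) (nhdsin (coord_space n) origin)"
    using lim by (rule eventually_compose_filterlim)
  then obtain s where s: "s > 0" "\<And>z. z \<in> polydisc n origin s \<Longrightarrow> H z \<in> polydisc n origin r"
    by (auto simp: eventually_nhdsin_polydisc)
  have "\<exists>e>0. \<forall>S \<gamma>. open S \<longrightarrow> (\<forall>i<n. (\<lambda>t. \<gamma> t i) holomorphic_on S) \<longrightarrow>
      (\<forall>t\<in>S. \<gamma> t \<in> polydisc n origin e) \<longrightarrow> (\<lambda>t. H (\<gamma> t) j) holomorphic_on S" if "j < n" for j
    using analytic_along_holomorphic_curve[OF H[OF that]] by metis
  then obtain e where e: "\<And>j. j < n \<Longrightarrow> e j > 0" and H_hol: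
    "\<And>j S \<gamma>. j < n \<Longrightarrow> open S \<Longrightarrow> (\<And>i. i < n \<Longrightarrow> (\<lambda>t. \<gamma> t i) holomorphic_on S) \<Longrightarrow>
      (\<And>t. t \<in> S \<Longrightarrow> \<gamma> t \<in> polydisc n origin (e j)) \<Longrightarrow> (\<lambda>t. H (\<gamma> t) j) holomorphic_on S"
    by metis
  define d where "d = Min (insert s (e ` {..<n}))"
  have d: "d > 0" "d \<le> s" "\<And>j. j < n \<Longrightarrow> d \<le> e j"
    using s(1) e by (auto simp: d_def)
  show ?thesis
  proof (rule separately_holomorphicI[OF d(1)])
    fix S :: "complex set" and \<gamma> :: "complex \<Rightarrow> nat \<Rightarrow> complex"
    assume S: "open S" and hol: "\<And>i. i < n \<Longrightarrow> (\<lambda>t. \<gamma> t i) holomorphic_on S"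
      and mem: "\<And>t. t \<in> S \<Longrightarrow> \<gamma> t \<in> polydisc n origin d"
    show "(\<lambda>t. f (H (\<gamma> t))) holomorphic_on S"
    proof (rule f_hol[OF S])
      show "(\<lambda>t. H (\<gamma> t) j) holomorphic_on S" if "j < n" for j
      proof (rule H_hol[OF that S])
        show "\<gamma> t \<in> polydisc n origin (e j)" if "t \<in> S" for t
          using mem[OF that] polydisc_mono[OF d(3)[OF \<open>j < n\<close>]] by blast
      qed (rule hol)
      show "H (\<gamma> t) \<in> polydisc n origin r" if "t \<in> S" for t
        by (intro s(2) subsetD[OF polydisc_mono[OF d(2)] mem[OF that]])
    qed
  qed
qed

context
  fixes n \<phi> F
  assumes F: "complexifies n \<phi> F"
begin

lemma complexifies_tendsto:
  "filterlim F (nhdsin (coord_space n) origin) (nhdsin (coord_space n) origin)"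
proof -
  have "F origin = origin" and "\<And>i. i < n \<Longrightarrow> analytic_fun_at n (\<lambda>z. F z i) origin"
    and into: "\<And>z. z \<in> topspace (coord_space n) \<Longrightarrow> F z \<in> topspace (coord_space n)"
    using F by (auto simp: complexifies_def)
  moreover have "eventually (\<lambda>z. F z \<in> topspace (coord_space n)) (nhdsin (coord_space n) origin)"
    using eventually_in_topspace by eventually_elim (rule into)
  ultimately show ?thesis
    using analytic_map_tendsto[of n F origin] by simp
qed

lemma complexified_tendsto:
  "filterlim \<phi> (nhdsin (coord_space n) (\<lambda>_. 0)) (nhdsin (coord_space n) (\<lambda>_. 0))"
  unfolding filterlim_iff
proof (intro allI impI)
  fix P assume "eventually P (nhdsin (coord_space n) (\<lambda>_. 0 :: real))"
  then obtain r where r: "r > 0" "\<forall>y\<in>polydisc n (\<lambda>_. 0) r. P y"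
    by (auto simp: eventually_nhdsin_polydisc)
  have "eventually (\<lambda>z. z \<in> polydisc n origin r) (nhdsin (coord_space n) origin)"
    using r by (auto simp: eventually_nhdsin_polydisc)
  then have "eventually (\<lambda>z. F z \<in> polydisc n origin r) (nhdsin (coord_space n) origin)"
    using complexifies_tendsto by (rule eventually_compose_filterlim)
  then have "eventually (\<lambda>y. F (of_real \<circ> y) \<in> polydisc n origin r) (nhdsin (coord_space n) (\<lambda>_. 0))"
    using of_real_comp_tendsto_origin by (rule eventually_compose_filterlim)
  moreover have "eventually (\<lambda>y. F (of_real \<circ> y) = of_real \<circ> \<phi> y) (nhdsin (coord_space n) (\<lambda>_. 0))"
    using F by (simp add: complexifies_def)
  ultimately show "eventually (\<lambda>y. P (\<phi> y)) (nhdsin (coord_space n) (\<lambda>_. 0))"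
    by eventually_elim (use r(2) in \<open>simp add: of_real_comp_in_polydisc_iff\<close>)
qed

text \<open>The uniqueness theorem, in the form in which it is applied to composites and to the
  identity.\<close>

lemma complexifies_eqI:
  assumes "\<And>i. i < n \<Longrightarrow> separately_holomorphic n (\<lambda>z. K z i)"
    and "eventually (\<lambda>z. K z \<in> topspace (coord_space n)) (nhdsin (coord_space n) origin)"
    and "eventually (\<lambda>y. K (of_real \<circ> y) = of_real \<circ> \<phi> y) (nhdsin (coord_space n) (\<lambda>_. 0))"
  shows "eventually (\<lambda>z. F z = K z) (nhdsin (coord_space n) origin)"
proof -
  have FD: "\<And>i. i < n \<Longrightarrow> analytic_fun_at n (\<lambda>z. F z i) origin"
      "\<And>z. z \<in> topspace (coord_space n) \<Longrightarrow> F z \<in> topspace (coord_space n)"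
      "eventually (\<lambda>y. F (of_real \<circ> y) = of_real \<circ> \<phi> y) (nhdsin (coord_space n) (\<lambda>_. 0))"
    using F by (auto simp: complexifies_def)
  have "eventually (\<lambda>z. F z i = K z i) (nhdsin (coord_space n) origin)" if "i < n" for i
  proof (rule separately_holomorphic_eq)
    show "separately_holomorphic n (\<lambda>z. F z i)"
      by (intro analytic_imp_separately_holomorphic FD that)
    show "eventually (\<lambda>y. F (of_real \<circ> y) i = K (of_real \<circ> y) i) (nhdsin (coord_space n) (\<lambda>_. 0 :: real))"
      using FD(3) assms(3) by eventually_elim simp
  qed (use assms(1) that in blast)
  then have "eventually (\<lambda>z. \<forall>i\<in>{..<n}. F z i = K z i) (nhdsin (coord_space n) origin)"
    by (intro eventually_ball_finite) auto
  then show ?thesis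
    using assms(2) eventually_in_topspace
  proof eventually_elim
    case (elim z)
    show "F z = K z"
    proof
      fix i show "F z i = K z i"
        using elim(1,2) FD(2)[OF elim(3)] by (cases "i < n") (auto simp: topspace_coord_space)
    qed
  qed
qed

lemma complexifies_identity_iff:
  "eventually (\<lambda>z. F z = z) (nhdsin (coord_space n) origin) \<longleftrightarrow>
   eventually (\<lambda>y. \<phi> y = y) (nhdsin (coord_space n) (\<lambda>_. 0))"
proof
  assume "eventually (\<lambda>y. \<phi> y = y) (nhdsin (coord_space n) (\<lambda>_. 0))"
  then show "eventually (\<lambda>z. F z = z) (nhdsin (coord_space n) origin)"
    by (intro complexifies_eqI separately_holomorphic_coordinate eventually_in_topspace)
       (auto elim!: eventually_mono)
next
  assume "eventually (\<lambda>z. F z = z) (nhdsin (coord_space n) origin)"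
  then have "eventually (\<lambda>y. F (of_real \<circ> y) = of_real \<circ> y) (nhdsin (coord_space n) (\<lambda>_. 0))"
    using of_real_comp_tendsto_origin by (rule eventually_compose_filterlim)
  moreover have "eventually (\<lambda>y. F (of_real \<circ> y) = of_real \<circ> \<phi> y) (nhdsin (coord_space n) (\<lambda>_. 0))"
    using F by (simp add: complexifies_def)
  ultimately show "eventually (\<lambda>y. \<phi> y = y) (nhdsin (coord_space n) (\<lambda>_. 0))"
    by eventually_elim (auto simp: fun_eq_iff)
qed

end

lemma complexifies_compose:
  assumes F: "complexifies n \<phi> F" and H: "complexifies n \<psi> H" and K: "complexifies n \<theta> K"
    and eq: "eventually (\<lambda>y. \<theta> y = \<phi> (\<psi> y)) (nhdsin (coord_space n) (\<lambda>_. 0))"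
  shows "eventually (\<lambda>z. K z = F (H z)) (nhdsin (coord_space n) origin)"
proof (rule complexifies_eqI[OF K])
  show "separately_holomorphic n (\<lambda>z. F (H z) i)" if "i < n" for i
    using F H that
    by (intro analytic_compose_separately_holomorphic[OF _ _ complexifies_tendsto[OF H]])
       (auto simp: complexifies_def)
  show "eventually (\<lambda>z. F (H z) \<in> topspace (coord_space n)) (nhdsin (coord_space n) origin)"
    using eventually_in_topspace by eventually_elim (use F H in \<open>auto simp: complexifies_def\<close>)
  have "eventually (\<lambda>y. F (of_real \<circ> y) = of_real \<circ> \<phi> y) (nhdsin (coord_space n) (\<lambda>_. 0))"
    using F by (simp add: complexifies_def)
  then have "eventually (\<lambda>y. F (of_real \<circ> \<psi> y) = of_real \<circ> \<phi> (\<psi> y)) (nhdsin (coord_space n) (\<lambda>_. 0))"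
    using complexified_tendsto[OF H] by (rule eventually_compose_filterlim)
  moreover have "eventually (\<lambda>y. H (of_real \<circ> y) = of_real \<circ> \<psi> y) (nhdsin (coord_space n) (\<lambda>_. 0))"
    using H by (simp add: complexifies_def)
  ultimately show "eventually (\<lambda>y. F (H (of_real \<circ> y)) = of_real \<circ> \<theta> y) (nhdsin (coord_space n) (\<lambda>_. 0))"
    using eq by eventually_elim simp
qed

text \<open>Both maps are analytic on whole polydiscs around the origin, where moreover they undo each
  other.  Shrinking the polydiscs to the points that the maps send into the opposite polydisc
  makes them mutually inverse bijections between open sets.\<close>

lemma complexifies_analytic_diffeo:
  assumes F: "complexifies n \<phi> F" and H: "complexifies n \<psi> H"
    and HF: "eventually (\<lambda>z. H (F z) = z) (nhdsin (coord_space n) origin)"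
    and FH: "eventually (\<lambda>z. F (H z) = z) (nhdsin (coord_space n) origin)"
  shows "\<exists>U V. analytic_diffeo n U V F \<and> origin \<in> U"
proof -
  let ?S = "topspace (coord_space n) :: (nat \<Rightarrow> complex) set"
  have analytic_near: "eventually (\<lambda>z. \<forall>i\<in>{..<n}. analytic_fun_at n (\<lambda>z. K z i) z)
      (nhdsin (coord_space n) origin)" if "complexifies n \<theta> K" for \<theta> K
    using that by (intro eventually_ball_finite)
      (auto simp: complexifies_def intro!: eventually_analytic_fun_at)
  have into: "F z \<in> ?S" "H z \<in> ?S" if "z \<in> ?S" for z
    using F H that by (auto simp: complexifies_def)
  obtain r where r: "r > 0" "\<And>z. z \<in> polydisc n origin r \<Longrightarrow> H (F z) = z"
      "\<And>z i. z \<in> polydisc n origin r \<Longrightarrow> i < n \<Longrightarrow> analytic_fun_at n (\<lambda>z. F z i) z"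
    using eventually_conj[OF HF analytic_near[OF F]] by (auto simp: eventually_nhdsin_polydisc)
  obtain s where s: "s > 0" "\<And>z. z \<in> polydisc n origin s \<Longrightarrow> F (H z) = z"
      "\<And>z i. z \<in> polydisc n origin s \<Longrightarrow> i < n \<Longrightarrow> analytic_fun_at n (\<lambda>z. H z i) z"
    using eventually_conj[OF FH analytic_near[OF H]] by (auto simp: eventually_nhdsin_polydisc)
  define U where "U = {z \<in> polydisc n origin r. F z \<in> polydisc n origin s}"
  define V where "V = {z \<in> polydisc n origin s. H z \<in> polydisc n origin r}"
  have open_preimage: "openin (coord_space n) {z \<in> polydisc n origin d. K z \<in> polydisc n origin e}"
    if "\<And>z i. z \<in> polydisc n origin d \<Longrightarrow> i < n \<Longrightarrow> analytic_fun_at n (\<lambda>z. K z i) z"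
      and "\<And>z. z \<in> ?S \<Longrightarrow> K z \<in> ?S" for K d e
  proof (rule openin_coord_spaceI)
    fix a assume a: "a \<in> {z \<in> polydisc n origin d. K z \<in> polydisc n origin e}"
    have aS: "a \<in> ?S"
      using a by (auto dest: polydiscD)
    have "eventually (\<lambda>z. K z \<in> polydisc n origin e) (nhdsin (coord_space n) a)"
    proof -
      have "filterlim K (nhdsin (coord_space n) (K a)) (nhdsin (coord_space n) a)"
        using a by (intro analytic_map_tendsto that(1) aS eventually_mono[OF eventually_in_topspace that(2)])
          auto
      moreover have "eventually (\<lambda>z. z \<in> polydisc n origin e) (nhdsin (coord_space n) (K a))"
        using a by (intro eventually_in_open openin_polydisc) simp
      ultimately show ?thesis
        by (rule eventually_compose_filterlim[rotated])
    qed
    moreover have "eventually (\<lambda>z. z \<in> polydisc n origin d) (nhdsin (coord_space n) a)"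
      using a by (intro eventually_in_open openin_polydisc) simp
    ultimately have "eventually (\<lambda>z. z \<in> {z \<in> polydisc n origin d. K z \<in> polydisc n origin e})
        (nhdsin (coord_space n) a)"
      by eventually_elim simp
    then show "\<exists>t>0. polydisc n a t \<subseteq> {z \<in> polydisc n origin d. K z \<in> polydisc n origin e}"
      unfolding eventually_nhdsin_polydisc[OF aS] by blast
  qed (auto dest: polydiscD)
  have UV: "openin (coord_space n) U" "openin (coord_space n) V"
    unfolding U_def V_def using r(3) s(3) into by (auto intro!: open_preimage)
  have bij: "bij_betw F U V"
    by (rule bij_betwI[of _ _ _ H]) (auto simp: U_def V_def r(2) s(2))
  have inv: "inv_into U F z = H z" if "z \<in> V" for z
    using that s(2) by (intro inv_into_f_eq[OF bij_betw_imp_inj_on[OF bij]]) (auto simp: U_def V_def)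
  have "analytic_fun_at n (\<lambda>z. inv_into U F z i) a" if "a \<in> V" "i < n" for a i
  proof (rule analytic_fun_at_cong)
    show "analytic_fun_at n (\<lambda>z. H z i) a" "a \<in> ?S"
      using that s(3) by (auto simp: V_def dest: polydiscD)
    show "eventually (\<lambda>z. H z i = inv_into U F z i) (nhdsin (coord_space n) a)"
      unfolding eventually_nhdsin using UV(2) that(1) inv by auto
  qed
  moreover have "origin \<in> U"
    using F r(1) s(1) by (auto simp: U_def complexifies_def centre_in_polydisc)
  ultimately show ?thesis
    using UV bij r(3) unfolding analytic_diffeo_def analytic_map_def
    by (intro exI[of _ U] exI[of _ V]) (auto simp: U_def)
qed

section \<open>Germs of diffeomorphisms\<close>

lemma germ_eq_iff:
  "germ n f = germ n g \<longleftrightarrow> eventually (\<lambda>z. f z = g z) (nhdsin (coord_space n) origin)"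
proof
  assume "germ n f = germ n g"
  moreover have "f \<in> germ n f"
    by (simp add: germ_def)
  ultimately show "eventually (\<lambda>z. f z = g z) (nhdsin (coord_space n) origin)"
    by (simp add: germ_def)
next
  assume eq: "eventually (\<lambda>z. f z = g z) (nhdsin (coord_space n) origin)"
  have "eventually (\<lambda>z. h z = f z) (nhdsin (coord_space n) origin) \<longleftrightarrow>
      eventually (\<lambda>z. h z = g z) (nhdsin (coord_space n) origin)" for h
    by (rule eventually_subst) (use eq in eventually_elim, simp)
  then show "germ n f = germ n g"
    by (simp add: germ_def)
qed

text \<open>Representatives of the left factor may differ away from the origin; as \<open>g\<close> tends to the
  origin, its values stay where they agree.\<close>

lemma mult_Diff_germs:
  assumes g: "filterlim g (nhdsin (coord_space n) origin) (nhdsin (coord_space n) origin)"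
  shows "germ n f \<otimes>\<^bsub>Diff_germs n\<^esub> germ n g = germ n (f \<circ> g)"
proof -
  have same: "germ n (f' \<circ> g') = germ n (f \<circ> g)" if "f' \<in> germ n f" "g' \<in> germ n g" for f' g'
  proof -
    have "eventually (\<lambda>z. f' (g z) = f (g z)) (nhdsin (coord_space n) origin)"
      using that(1) by (intro eventually_compose_filterlim[OF _ g]) (simp add: germ_def)
    moreover have "eventually (\<lambda>z. g' z = g z) (nhdsin (coord_space n) origin)"
      using that(2) by (simp add: germ_def)
    ultimately show ?thesis
      unfolding germ_eq_iff by eventually_elim simp
  qed
  have "f \<in> germ n f" "g \<in> germ n g"
    by (simp_all add: germ_def)
  then have "(\<Union>f'\<in>germ n f. \<Union>g'\<in>germ n g. germ n (f' \<circ> g')) = germ n (f \<circ> g)"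
    using same by blast
  then show ?thesis
    by (simp add: Diff_germs_def)
qed

lemma carrier_Diff_germs_rep:
  assumes "a \<in> carrier (Diff_germs n)"
  obtains f where "a = germ n f"
    "filterlim f (nhdsin (coord_space n) origin) (nhdsin (coord_space n) origin)"
proof -
  obtain f U V where f: "a = germ n f" "analytic_diffeo n U V f" "origin \<in> U" "f origin = origin"
    using assms by (auto simp: Diff_germs_def)
  have UV: "openin (coord_space n) U" "openin (coord_space n) V" "f ` U = V"
    using f(2) by (auto simp: analytic_diffeo_def bij_betw_def)
  have "eventually (\<lambda>z. z \<in> U) (nhdsin (coord_space n) origin)"
    using UV(1) f(3) by (rule eventually_in_open)
  then have "eventually (\<lambda>z. f z \<in> topspace (coord_space n)) (nhdsin (coord_space n) origin)"
    by eventually_elim (use UV(3) openin_subset[OF UV(2)] in auto)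
  then have "filterlim f (nhdsin (coord_space n) (f origin)) (nhdsin (coord_space n) origin)"
    using f(2,3) by (intro analytic_map_tendsto) (auto simp: analytic_diffeo_def analytic_map_def)
  with f(1,4) that show thesis
    by simp
qed

text \<open>The inverse is a definite description over the carrier, so its value has to be shown unique;
  associativity of composition of germs settles this as in any monoid.\<close>

lemma inv_Diff_germs_eq:
  assumes "a \<in> carrier (Diff_germs n)" "b \<in> carrier (Diff_germs n)"
    and "a \<otimes>\<^bsub>Diff_germs n\<^esub> b = germ n id" "b \<otimes>\<^bsub>Diff_germs n\<^esub> a = germ n id"
  shows "inv\<^bsub>Diff_germs n\<^esub> a = b"
  unfolding m_inv_def
proof (rule the_equality)
  show "b \<in> carrier (Diff_germs n) \<and> a \<otimes>\<^bsub>Diff_germs n\<^esub> b = \<one>\<^bsub>Diff_germs n\<^esub> \<and>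
      b \<otimes>\<^bsub>Diff_germs n\<^esub> a = \<one>\<^bsub>Diff_germs n\<^esub>"
    using assms by (simp add: Diff_germs_def)
next
  fix c assume c: "c \<in> carrier (Diff_germs n) \<and> a \<otimes>\<^bsub>Diff_germs n\<^esub> c = \<one>\<^bsub>Diff_germs n\<^esub> \<and>
      c \<otimes>\<^bsub>Diff_germs n\<^esub> a = \<one>\<^bsub>Diff_germs n\<^esub>"
  obtain f where f: "a = germ n f"
      "filterlim f (nhdsin (coord_space n) origin) (nhdsin (coord_space n) origin)"
    using carrier_Diff_germs_rep[OF assms(1)] .
  obtain g where g: "b = germ n g"
      "filterlim g (nhdsin (coord_space n) origin) (nhdsin (coord_space n) origin)"
    using carrier_Diff_germs_rep[OF assms(2)] .
  obtain h where h: "c = germ n h"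
      "filterlim h (nhdsin (coord_space n) origin) (nhdsin (coord_space n) origin)"
    using carrier_Diff_germs_rep c by blast
  have "c \<otimes>\<^bsub>Diff_germs n\<^esub> a = germ n id"
    using c by (simp add: Diff_germs_def)
  then have hf: "eventually (\<lambda>z. h (f z) = z) (nhdsin (coord_space n) origin)"
    by (simp add: f h mult_Diff_germs germ_eq_iff)
  have fg: "eventually (\<lambda>z. f (g z) = z) (nhdsin (coord_space n) origin)"
    using assms(3) by (simp add: f g mult_Diff_germs germ_eq_iff)
  have "eventually (\<lambda>z. h z = g z) (nhdsin (coord_space n) origin)"
    using eventually_compose_filterlim[OF hf g(2)] fg by eventually_elim simp
  then show "c = b"
    by (simp add: g h germ_eq_iff)
qed

section \<open>Derived length of an isomorphic image\<close>

text \<open>It is the image of \<open>h\<close> that becomes a group, by transport of structure, whence the derived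
  series of \<open>G\<close> is carried to that of the image.\<close>

lemma derived_length_hom_image:
  assumes "group G" "h \<in> hom G K" "inj_on h (carrier G)" "h \<one>\<^bsub>G\<^esub> = \<one>\<^bsub>K\<^esub>"
  shows "derived_length (K\<lparr>carrier := h ` carrier G\<rparr>) = derived_length G"
proof -
  interpret G: group G by fact
  let ?H = "K\<lparr>carrier := h ` carrier G\<rparr>"
  have "?H = K\<lparr>carrier := h ` carrier G, one := h \<one>\<^bsub>G\<^esub>\<rparr>"
    by (cases K) (use assms(4) in simp)
  then have "group ?H"
    using G.hom_imp_img_group[OF assms(2)] by simp
  then have h: "group_hom G ?H h"
    using assms(1,2) by (auto simp: group_hom_def group_hom_axioms_def hom_def)
  have "(derived ?H ^^ k) (carrier ?H) = {\<one>\<^bsub>?H\<^esub>} \<longleftrightarrow> (derived G ^^ k) (carrier G) = {\<one>\<^bsub>G\<^esub>}" for k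
  proof -
    have "(derived ?H ^^ k) (carrier ?H) = h ` (derived G ^^ k) (carrier G)"
      using group_hom.exp_of_derived_img[OF h, of "carrier G" k] by simp
    moreover have "{\<one>\<^bsub>?H\<^esub>} = h ` {\<one>\<^bsub>G\<^esub>}"
      using assms(4) by simp
    moreover have "(derived G ^^ k) (carrier G) \<subseteq> carrier G"
      by (rule G.exp_of_derived_in_carrier) simp
    ultimately show ?thesis
      using inj_on_image_eq_iff[OF assms(3), of "(derived G ^^ k) (carrier G)" "{\<one>\<^bsub>G\<^esub>}"] by simp
  qed
  then show ?thesis
    unfolding derived_length_def by simp
qed

section \<open>The identity principle for real power series\<close>

text \<open>Join the centre \<open>b\<close> of a polydisc of agreement to \<open>y\<close> by a straight line and let the
  parameter be complex: the complexification of \<open>f\<close>, minus the coordinate, is holomorphic on the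
  convex set of parameters for which the line stays in the polydisc of convergence, and it
  vanishes for small real parameters.\<close>

lemma real_analytic_eq_coordinate:
  fixes f :: "(nat \<Rightarrow> real) \<Rightarrow> real"
  assumes "analytic_fun_at n f (\<lambda>_. 0)" "i < n"
  obtains r where "r > 0" and
    "\<And>b s y. b \<in> polydisc n (\<lambda>_. 0) r \<Longrightarrow> s > 0 \<Longrightarrow> (\<And>u. u \<in> polydisc n b s \<Longrightarrow> f u = u i) \<Longrightarrow>
      y \<in> polydisc n (\<lambda>_. 0) r \<Longrightarrow> f y = y i"
proof -
  obtain fc r0 where r0: "r0 > 0" and fc: "analytic_fun_at n fc (of_real \<circ> (\<lambda>_. 0))"
    "\<And>y. y \<in> polydisc n (\<lambda>_. 0) r0 \<Longrightarrow> fc (of_real \<circ> y) = complex_of_real (f y)"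
    using real_analytic_extends[OF assms(1)] by metis
  have "analytic_fun_at n fc origin"
    using fc(1) by (simp add: comp_def)
  then obtain r1 where r1: "r1 > 0" and hol:
    "\<And>S \<gamma>. open S \<Longrightarrow> (\<And>i. i < n \<Longrightarrow> (\<lambda>t. \<gamma> t i) holomorphic_on S) \<Longrightarrow>
      (\<And>t. t \<in> S \<Longrightarrow> \<gamma> t \<in> polydisc n origin r1) \<Longrightarrow> (\<lambda>t. fc (\<gamma> t)) holomorphic_on S"
    using analytic_along_holomorphic_curve[of n fc origin] by metis
  define r where "r = min r0 r1"
  have r: "r > 0" "r \<le> r0" "r \<le> r1"
    using r0 r1 by (auto simp: r_def)
  show thesis
  proof (rule that[OF r(1)])
    fix b y :: "nat \<Rightarrow> real" and s :: real
    assume b: "b \<in> polydisc n (\<lambda>_. 0) r" and s: "s > 0"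
      and eq: "\<And>u. u \<in> polydisc n b s \<Longrightarrow> f u = u i" and y: "y \<in> polydisc n (\<lambda>_. 0) r"
    define \<gamma> where "\<gamma> t j = of_real (b j) + t * of_real (y j - b j)" for t :: complex and j
    define S where "S = (\<Inter>j\<in>{..<n}. {t. norm (\<gamma> t j) < r})"
    have "open {t. norm (\<gamma> t j) < r}" for j
      unfolding \<gamma>_def by (intro open_Collect_less continuous_intros)
    then have openS: "open S"
      unfolding S_def by (intro open_INT) auto
    have "convex {t. norm (\<gamma> t j) < r}" for j
    proof -
      have "{t. norm (\<gamma> t j) < r} = (\<lambda>t. t * of_real (y j - b j)) -` ball (- of_real (b j)) r"
        by (auto simp: \<gamma>_def dist_norm norm_minus_commute[of "- of_real (b j)"] add.commute)
      then show ?thesis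
        by (simp add: convex_linear_vimage[OF _ convex_ball] bounded_linear.linear[OF bounded_linear_mult_left])
    qed
    then have connS: "connected S"
      unfolding S_def by (intro convex_connected convex_INT) auto
    have \<gamma>_mem: "\<gamma> t \<in> polydisc n origin r" if "t \<in> S" for t
      using that b y by (auto simp: S_def \<gamma>_def polydisc_def topspace_coord_space)
    have \<gamma>_of_real: "\<gamma> (of_real t) = of_real \<circ> (\<lambda>j. b j + t * (y j - b j))" for t
      by (auto simp: \<gamma>_def fun_eq_iff)
    have "\<gamma> 0 = of_real \<circ> b" "\<gamma> 1 = of_real \<circ> y"
      by (auto simp: \<gamma>_def fun_eq_iff)
    then have S01: "0 \<in> S" "1 \<in> S"
      using polydiscD(2)[OF b] polydiscD(2)[OF y] by (auto simp: S_def)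
    \<comment> \<open>Two points of the polydisc of radius \<open>r\<close> differ by less than \<open>2 * r\<close> in each coordinate, so
      real parameters below \<open>\<delta>\<close> keep the line within \<open>s\<close> of \<open>b\<close>.\<close>
    define \<delta> where "\<delta> = s / (2 * r)"
    have \<delta>: "\<delta> > 0"
      using s r(1) by (simp add: \<delta>_def)
    let ?h = "\<lambda>t. fc (\<gamma> t) - \<gamma> t i"
    obtain d where d: "d > 0" "ball 0 d \<subseteq> S"
      using openS S01(1) open_contains_ball by blast
    have "?h 1 = 0"
    proof (rule analytic_continuation[of ?h S "\<real> \<inter> ball 0 (min d \<delta>)" 0])
      have \<gamma>_hol: "(\<lambda>t. \<gamma> t j) holomorphic_on S" for j
        unfolding \<gamma>_def by (intro holomorphic_intros)
      have "(\<lambda>t. fc (\<gamma> t)) holomorphic_on S"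
        by (intro hol openS \<gamma>_hol subsetD[OF polydisc_mono[OF r(3)] \<gamma>_mem])
      then show "?h holomorphic_on S"
        by (intro holomorphic_on_diff \<gamma>_hol)
      show "(0::complex) islimpt (\<real> \<inter> ball 0 (min d \<delta>))"
        using d(1) \<delta> by (intro zero_islimpt_Reals) simp
      show "?h t = 0" if t: "t \<in> \<real> \<inter> ball 0 (min d \<delta>)" for t
      proof -
        obtain \<tau> where \<tau>: "t = of_real \<tau>" "\<bar>\<tau>\<bar> < \<delta>"
          using t by (auto elim!: Reals_cases)
        have tS: "t \<in> S"
          using t by (intro subsetD[OF d(2)]) simp
        let ?u = "\<lambda>j. b j + \<tau> * (y j - b j)"
        have "(of_real \<circ> ?u :: nat \<Rightarrow> complex) \<in> polydisc n origin r"
          using \<gamma>_mem[OF tS] unfolding \<tau>(1) \<gamma>_of_real .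
        then have u: "?u \<in> polydisc n (\<lambda>_. 0) r"
          by (simp only: of_real_comp_in_polydisc_iff)
        have "\<bar>\<tau> * (y j - b j)\<bar> < s" if "j < n" for j
        proof -
          have "\<bar>y j - b j\<bar> \<le> 2 * r"
            using polydiscD(2)[OF b that] polydiscD(2)[OF y that] by simp
          then have "\<bar>\<tau>\<bar> * \<bar>y j - b j\<bar> \<le> \<bar>\<tau>\<bar> * (2 * r)"
            by (intro mult_left_mono) auto
          also have "\<dots> < \<delta> * (2 * r)"
            using \<tau>(2) r(1) by (intro mult_strict_right_mono) auto
          finally show ?thesis
            using r(1) by (simp add: \<delta>_def abs_mult)
        qed
        then have "?u \<in> polydisc n b s"
          using polydiscD(1)[OF u] by (simp add: polydisc_def)
        then have "fc (of_real \<circ> ?u) = of_real (?u i)"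
          using fc(2)[of ?u] eq u polydisc_mono[OF r(2)] by auto
        then show ?thesis
          unfolding \<tau>(1) \<gamma>_of_real by simp
      qed
    qed (use openS connS S01 d(2) in auto)
    then have "fc (of_real \<circ> y) = of_real (y i)"
      using \<open>\<gamma> 1 = of_real \<circ> y\<close> by simp
    then show "f y = y i"
      using fc(2)[OF subsetD[OF polydisc_mono[OF r(2)] y]] by simp
  qed
qed

section \<open>Self-maps in a chart around a fixed point\<close>

lemma analytic_fun_at_recentre:
  fixes f :: "(nat \<Rightarrow> 'k::real_normed_field) \<Rightarrow> 'k"
  assumes "analytic_fun_at n f a" "a \<in> topspace (coord_space n)"
  shows "analytic_fun_at n (\<lambda>y. f (\<lambda>i. y i + a i) - k) (\<lambda>_. 0)"
proof -
  obtain r c where r: "r > 0" and f: "expands_on n f a r c"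
    using assms(1) by (auto simp: analytic_fun_at_iff_expands_on)
  \<comment> \<open>Subtracting a constant affects only the coefficient of the empty monomial.\<close>
  define d where "d \<alpha> = c \<alpha> + (if \<alpha> = (\<lambda>_. 0) then - k else 0)" for \<alpha>
  have "expands_on n (\<lambda>y. f (\<lambda>i. y i + a i) - k) (\<lambda>_. 0) r d"
    unfolding expands_on_def
  proof
    fix y :: "nat \<Rightarrow> 'k" assume y: "y \<in> polydisc n (\<lambda>_. 0) r"
    have "(\<lambda>i. y i + a i) \<in> polydisc n a r"
      using y assms(2) by (auto simp: polydisc_def topspace_coord_space)
    then have "((\<lambda>\<alpha>. c \<alpha> * (\<Prod>i<n. (y i + a i - a i) ^ \<alpha> i)) has_sum f (\<lambda>i. y i + a i)) (multi_indices n)"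
      using f unfolding expands_on_def by (rule bspec[rotated])
    moreover have "((\<lambda>\<alpha>. (if \<alpha> = (\<lambda>_. 0) then - k else 0) * (\<Prod>i<n. y i ^ \<alpha> i)) has_sum - k) (multi_indices n)"
      by (rule has_sum_finite_neutralI[of "{\<lambda>_. 0}"]) (auto simp: multi_indices_def)
    ultimately have "((\<lambda>\<alpha>. c \<alpha> * (\<Prod>i<n. (y i + a i - a i) ^ \<alpha> i) +
        (if \<alpha> = (\<lambda>_. 0) then - k else 0) * (\<Prod>i<n. y i ^ \<alpha> i)) has_sum f (\<lambda>i. y i + a i) + - k)
        (multi_indices n)"
      by (rule has_sum_add)
    then show "((\<lambda>\<alpha>. d \<alpha> * (\<Prod>i<n. (y i - 0) ^ \<alpha> i)) has_sum f (\<lambda>i. y i + a i) - k) (multi_indices n)"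
      unfolding d_def by (simp add: distrib_right)
  qed
  with r show ?thesis
    unfolding analytic_fun_at_iff_expands_on by blast
qed

lemma chart_at:
  assumes "real_analytic_manifold n M A" "q \<in> topspace M"
  obtains U x where "(U, x) \<in> A" "q \<in> U"
proof -
  have "(\<Union>(U, x)\<in>A. U) = topspace M"
    using assms(1) by (simp add: real_analytic_manifold_def)
  then have "q \<in> (\<Union>(U, x)\<in>A. U)"
    using assms(2) by simp
  then show thesis
    using that by auto
qed

text \<open>The map \<open>g\<close> in the chart \<open>x\<close>, translated so that \<open>x p\<close> becomes the origin, which is the base
  point of the germs in \<^term>\<open>Diff_germs n\<close>.\<close>

definition centred_rep :: "'a set \<Rightarrow> ('a \<Rightarrow> nat \<Rightarrow> real) \<Rightarrow> 'a \<Rightarrow> ('a \<Rightarrow> 'a) \<Rightarrow> (nat \<Rightarrow> real) \<Rightarrow> nat \<Rightarrow> real" where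
  "centred_rep U x p g y = (\<lambda>i. x (g (inv_into U x (\<lambda>i. y i + x p i))) i - x p i)"

context
  fixes n :: nat and M :: "'a topology" and A U x p
  assumes M: "real_analytic_manifold n M A" and chart: "(U, x) \<in> A" and p: "p \<in> U"
begin

lemma chart_open: "openin M U" "openin (coord_space n) (x ` U)"
  and chart_homeo: "homeomorphic_map (subtopology M U) (subtopology (coord_space n) (x ` U)) x"
  using M chart by (auto simp: real_analytic_manifold_def)

lemma chart_inj: "inj_on x U"
  using homeomorphic_imp_injective_map[OF chart_homeo] openin_subset[OF chart_open(1)]
  by (simp add: Int_absorb1)

lemma chart_in_coord_space: "q \<in> U \<Longrightarrow> x q \<in> topspace (coord_space n)"
  using openin_subset[OF chart_open(2)] by auto

lemma inv_chart: "q \<in> U \<Longrightarrow> inv_into U x (x q) = q"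
  by (rule inv_into_f_f[OF chart_inj])

lemma chart_image_open:
  assumes "openin M W"
  shows "openin (coord_space n) (x ` (U \<inter> W))"
proof -
  have "openin (subtopology M U) (U \<inter> W)"
    using assms by (auto simp: openin_subtopology)
  then have "openin (subtopology (coord_space n) (x ` U)) (x ` (U \<inter> W))"
    using homeomorphic_imp_open_map[OF chart_homeo] by (auto simp: open_map_def)
  then show ?thesis
    using chart_open(2) by (simp add: openin_open_subtopology)
qed

lemma chart_preimage_open:
  assumes "openin (coord_space n) W"
  shows "openin M {q \<in> U. x q \<in> W}"
proof -
  have "continuous_map (subtopology M U) (coord_space n) x"
    using homeomorphic_imp_continuous_map[OF chart_homeo] by (rule continuous_map_into_fulltopology)
  then have "openin (subtopology M U) {q \<in> topspace (subtopology M U). x q \<in> W}"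
    using assms by (rule openin_continuous_map_preimage)
  moreover have "{q \<in> topspace (subtopology M U). x q \<in> W} = {q \<in> U. x q \<in> W}"
    using openin_subset[OF chart_open(1)] by auto
  ultimately show ?thesis
    using chart_open(1) by (simp add: openin_open_subtopology)
qed

lemma eventually_near_chart_point:
  assumes "openin M W" "p \<in> W"
  shows "eventually (\<lambda>y. \<exists>w\<in>U \<inter> W. (\<lambda>i. y i + x p i) = x w) (nhdsin (coord_space n) (\<lambda>_. 0))"
proof -
  obtain r where r: "r > 0" "polydisc n (x p) r \<subseteq> x ` (U \<inter> W)"
    using openin_contains_polydisc[OF chart_image_open[OF assms(1)], of "x p"] assms(2) p by auto
  have "(\<lambda>i. y i + x p i) \<in> polydisc n (x p) r" if "y \<in> polydisc n (\<lambda>_. 0) r" for y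
    using that chart_in_coord_space[OF p] by (auto simp: polydisc_def topspace_coord_space)
  with r show ?thesis
    by (auto simp: eventually_nhdsin_polydisc image_iff subset_iff)
qed

lemma eventually_centred_imp_near:
  assumes "eventually P (nhdsin (coord_space n) (\<lambda>_. 0))"
  obtains W where "openin M W" "p \<in> W" "W \<subseteq> U" "\<And>w. w \<in> W \<Longrightarrow> P (\<lambda>i. x w i - x p i)"
proof -
  obtain r where r: "r > 0" "\<forall>y\<in>polydisc n (\<lambda>_. 0) r. P y"
    using assms by (auto simp: eventually_nhdsin_polydisc)
  show thesis
  proof (rule that)
    show "openin M {q \<in> U. x q \<in> polydisc n (x p) r}"
      by (intro chart_preimage_open openin_polydisc)
    show "p \<in> {q \<in> U. x q \<in> polydisc n (x p) r}"
      using p r(1) chart_in_coord_space[OF p] by (simp add: centre_in_polydisc)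
    fix w assume "w \<in> {q \<in> U. x q \<in> polydisc n (x p) r}"
    then have "(\<lambda>i. x w i - x p i) \<in> polydisc n (\<lambda>_. 0) r"
      using chart_in_coord_space[OF p] by (auto simp: polydisc_def topspace_coord_space)
    with r(2) show "P (\<lambda>i. x w i - x p i)"
      by blast
  qed auto
qed

lemma centred_rep_eq:
  "w \<in> U \<Longrightarrow> (\<lambda>i. y i + x p i) = x w \<Longrightarrow> centred_rep U x p g y = (\<lambda>i. x (g w) i - x p i)"
  by (simp add: centred_rep_def inv_chart)

context
  fixes g
  assumes g: "real_analytic_self_map n M A g" and gp: "g p = p"
begin

lemma self_map_preimage_open: "openin M W \<Longrightarrow> openin M {q \<in> topspace M. g q \<in> W}"
  using g openin_continuous_map_preimage[of M M g W] by (simp add: real_analytic_self_map_def)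

lemma p_in_preimage: "p \<in> {q \<in> topspace M. g q \<in> U}"
  using p gp openin_subset[OF chart_open(1)] by auto

lemma centred_rep_zero: "centred_rep U x p g (\<lambda>_. 0) = (\<lambda>_. 0)"
  using centred_rep_eq[OF p, of "\<lambda>_. 0"] gp by simp

lemma centred_rep_analytic:
  assumes "i < n"
  shows "analytic_fun_at n (\<lambda>y. centred_rep U x p g y i) (\<lambda>_. 0)"
proof -
  have "analytic_map n (x ` (U \<inter> g -` U)) (x \<circ> g \<circ> inv_into U x)"
    using g chart unfolding real_analytic_self_map_def by fast
  then have "analytic_fun_at n (\<lambda>u. (x \<circ> g \<circ> inv_into U x) u i) (x p)"
    using p gp assms by (auto simp: analytic_map_def)
  from analytic_fun_at_recentre[OF this chart_in_coord_space[OF p], of "x p i"]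
  show ?thesis
    by (simp add: centred_rep_def)
qed

lemma centred_rep_complexification: "\<exists>F. complexifies n (centred_rep U x p g) F"
proof (rule ex_complexification)
  have "eventually (\<lambda>y. \<exists>w\<in>U \<inter> {q \<in> topspace M. g q \<in> U}. (\<lambda>i. y i + x p i) = x w)
      (nhdsin (coord_space n) (\<lambda>_. 0))"
    by (intro eventually_near_chart_point self_map_preimage_open chart_open p_in_preimage)
  then show "eventually (\<lambda>y. centred_rep U x p g y \<in> topspace (coord_space n))
      (nhdsin (coord_space n) (\<lambda>_. 0))"
  proof eventually_elim
    case (elim y)
    then obtain w where "w \<in> U" "g w \<in> U" "(\<lambda>i. y i + x p i) = x w"
      by auto
    then show ?case
      using chart_in_coord_space[of "g w"] chart_in_coord_space[OF p]
      by (simp add: centred_rep_eq topspace_coord_space)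
  qed
qed (simp_all add: centred_rep_zero centred_rep_analytic)

text \<open>It suffices to look at points that \<open>g\<close> keeps in the chart domain, where going back from
  coordinates to the manifold between the two maps changes nothing.\<close>

lemma centred_rep_compose:
  assumes "\<And>q. q \<in> topspace M \<Longrightarrow> k q = f (g q)"
  shows "eventually (\<lambda>y. centred_rep U x p k y = centred_rep U x p f (centred_rep U x p g y))
    (nhdsin (coord_space n) (\<lambda>_. 0))"
proof -
  have "eventually (\<lambda>y. \<exists>w\<in>U \<inter> {q \<in> topspace M. g q \<in> U}. (\<lambda>i. y i + x p i) = x w)
      (nhdsin (coord_space n) (\<lambda>_. 0))"
    by (intro eventually_near_chart_point self_map_preimage_open chart_open p_in_preimage)
  then show ?thesis
  proof eventually_elim
    case (elim y)
    then obtain w where w: "w \<in> U" "w \<in> topspace M" "g w \<in> U" "(\<lambda>i. y i + x p i) = x w"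
      by auto
    have "centred_rep U x p f (centred_rep U x p g y) = (\<lambda>i. x (f (g w)) i - x p i)"
      by (rule centred_rep_eq[OF w(3)]) (simp add: centred_rep_eq[OF w(1,4)])
    then show ?case
      using assms[OF w(2)] by (simp add: centred_rep_eq[OF w(1,4)])
  qed
qed

lemma centred_rep_identity_imp:
  assumes "eventually (\<lambda>y. centred_rep U x p g y = y) (nhdsin (coord_space n) (\<lambda>_. 0))"
  shows "\<exists>W. openin M W \<and> p \<in> W \<and> (\<forall>w\<in>W. g w = w)"
proof -
  obtain W where W: "openin M W" "p \<in> W" "W \<subseteq> U"
    "\<And>w. w \<in> W \<Longrightarrow> centred_rep U x p g (\<lambda>i. x w i - x p i) = (\<lambda>i. x w i - x p i)"
    using eventually_centred_imp_near[OF assms] by blast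
  let ?W = "W \<inter> {q \<in> topspace M. g q \<in> U}"
  have "g w = w" if w: "w \<in> ?W" for w
  proof -
    have "w \<in> U"
      using w W(3) by blast
    then have "(\<lambda>i. x (g w) i - x p i) = (\<lambda>i. x w i - x p i)"
      using W(4)[of w] w centred_rep_eq[of w "\<lambda>i. x w i - x p i" g] by auto
    then have "x (g w) = x w"
      by (simp add: fun_eq_iff)
    then show ?thesis
      using inj_onD[OF chart_inj] w \<open>w \<in> U\<close> by blast
  qed
  then show ?thesis
    using W(1,2) self_map_preimage_open[OF chart_open(1)] p_in_preimage
    by (intro exI[of _ ?W]) (simp add: openin_Int)
qed

text \<open>The dichotomy behind closedness: around a fixed point there is a neighbourhood on which \<open>g\<close> is
  the identity as soon as it is the identity near one of its points.\<close>

lemma identity_principle_near_fixed_point: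
  obtains W where "openin M W" "p \<in> W"
    "\<And>e V. e \<in> W \<Longrightarrow> openin M V \<Longrightarrow> e \<in> V \<Longrightarrow> (\<And>v. v \<in> V \<Longrightarrow> g v = v) \<Longrightarrow> \<forall>w\<in>W. g w = w"
proof -
  let ?\<phi> = "centred_rep U x p g"
  have "\<exists>r>0. \<forall>b s y. b \<in> polydisc n (\<lambda>_. 0) r \<longrightarrow> s > 0 \<longrightarrow> (\<forall>u\<in>polydisc n b s. ?\<phi> u i = u i) \<longrightarrow>
      y \<in> polydisc n (\<lambda>_. 0) r \<longrightarrow> ?\<phi> y i = y i" if "i < n" for i
    using real_analytic_eq_coordinate[OF centred_rep_analytic[OF that] that] by metis
  then obtain \<rho> where \<rho>: "\<And>i. i < n \<Longrightarrow> \<rho> i > 0" and identity: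
    "\<And>i b s y. i < n \<Longrightarrow> b \<in> polydisc n (\<lambda>_. 0) (\<rho> i) \<Longrightarrow> s > 0 \<Longrightarrow>
      (\<And>u. u \<in> polydisc n b s \<Longrightarrow> ?\<phi> u i = u i) \<Longrightarrow> y \<in> polydisc n (\<lambda>_. 0) (\<rho> i) \<Longrightarrow> ?\<phi> y i = y i"
    by metis
  define r where "r = Min (insert 1 (\<rho> ` {..<n}))"
  have r: "r > 0" "\<And>i. i < n \<Longrightarrow> r \<le> \<rho> i"
    using \<rho> by (auto simp: r_def)
  have "eventually (\<lambda>y. y \<in> polydisc n (\<lambda>_. 0 :: real) r) (nhdsin (coord_space n) (\<lambda>_. 0))"
    using r(1) by (auto simp: eventually_nhdsin_polydisc)
  then obtain W where W: "openin M W" "p \<in> W" "W \<subseteq> U"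
    "\<And>w. w \<in> W \<Longrightarrow> (\<lambda>i. x w i - x p i) \<in> polydisc n (\<lambda>_. 0) r"
    using eventually_centred_imp_near by blast
  let ?W = "W \<inter> {q \<in> topspace M. g q \<in> U}"
  show thesis
  proof (rule that[of ?W])
    show "openin M ?W" "p \<in> ?W"
      using W(1,2) self_map_preimage_open[OF chart_open(1)] p_in_preimage by (simp_all add: openin_Int)
    fix e V assume e: "e \<in> ?W" and V: "openin M V" "e \<in> V" "\<And>v. v \<in> V \<Longrightarrow> g v = v"
    let ?c = "\<lambda>w i. x w i - x p i"
    have "e \<in> U"
      using e W(3) by blast
    then obtain s where s: "s > 0" "polydisc n (x e) s \<subseteq> x ` (U \<inter> V)"
      using openin_contains_polydisc[OF chart_image_open[OF V(1)], of "x e"] V(2) by auto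
    have near_e: "?\<phi> u = u" if u: "u \<in> polydisc n (?c e) s" for u
    proof -
      have "(\<lambda>i. u i + x p i) \<in> polydisc n (x e) s"
        using u chart_in_coord_space[OF p] by (auto simp: polydisc_def topspace_coord_space algebra_simps)
      then obtain v where v: "v \<in> U" "v \<in> V" "(\<lambda>i. u i + x p i) = x v"
        using s(2) by auto
      have "?\<phi> u = (\<lambda>i. x v i - x p i)"
        using centred_rep_eq[OF v(1,3), of g] V(3)[OF v(2)] by simp
      also have "\<dots> = u"
        by (simp flip: v(3))
      finally show ?thesis .
    qed
    show "\<forall>w\<in>?W. g w = w"
    proof
      fix w assume w: "w \<in> ?W"
      have wU: "w \<in> U" "g w \<in> U"
        using w W(3) by auto
      have "?\<phi> (?c w) i = ?c w i" if "i < n" for i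
      proof (rule identity[OF that _ s(1)])
        show "?c e \<in> polydisc n (\<lambda>_. 0) (\<rho> i)" "?c w \<in> polydisc n (\<lambda>_. 0) (\<rho> i)"
          using W(4)[of e] W(4)[of w] e w polydisc_mono[OF r(2)[OF that]] by blast+
      qed (simp add: near_e)
      moreover have "?\<phi> (?c w) = ?c (g w)"
        using centred_rep_eq[OF wU(1), of "?c w" g] by simp
      ultimately have "x (g w) i = x w i" if "i < n" for i
        using that by (simp add: fun_eq_iff)
      moreover have "x (g w) i = x w i" if "i \<ge> n" for i
        using chart_in_coord_space[OF wU(1)] chart_in_coord_space[OF wU(2)] that
        by (simp add: topspace_coord_space)
      ultimately have "x (g w) = x w"
        by (metis ext not_le)
      then show "g w = w"
        using inj_onD[OF chart_inj] wU by blast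
    qed
  qed
qed

end

end

section \<open>The identity principle on a connected real analytic manifold\<close>

text \<open>The set \<open>E\<close> of points near which \<open>g\<close> is the identity is open by construction.  Its complement
  is open at points that \<open>g\<close> moves because the fixed point set is closed in a Hausdorff space,
  and at fixed points by the dichotomy above.\<close>

lemma identity_principle_manifold:
  assumes M: "real_analytic_manifold n M A" and "connected_space M"
    and g: "real_analytic_self_map n M A g"
    and W: "openin M W" "p \<in> W" "\<And>w. w \<in> W \<Longrightarrow> g w = w" and "q \<in> topspace M"
  shows "g q = q"
proof -
  define E where "E = \<Union>{V. openin M V \<and> (\<forall>v\<in>V. g v = v)}"
  have E: "openin M E" "\<And>q. q \<in> E \<Longrightarrow> g q = q"
    unfolding E_def by auto
  have cont: "continuous_map M M g"
    using g by (simp add: real_analytic_self_map_def)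
  have Hausdorff: "Hausdorff_space M"
    using M by (simp add: real_analytic_manifold_def)
  have "openin M (topspace M - E)"
  proof (subst openin_subopen, intro ballI)
    fix q assume q: "q \<in> topspace M - E"
    show "\<exists>T. openin M T \<and> q \<in> T \<and> T \<subseteq> topspace M - E"
    proof (cases "g q = q")
      case True
      obtain U x where chart: "(U, x) \<in> A" "q \<in> U"
        using chart_at[OF M, of q] q by blast
      obtain T where T: "openin M T" "q \<in> T"
        "\<And>e V. e \<in> T \<Longrightarrow> openin M V \<Longrightarrow> e \<in> V \<Longrightarrow> (\<And>v. v \<in> V \<Longrightarrow> g v = v) \<Longrightarrow> \<forall>w\<in>T. g w = w"
        using identity_principle_near_fixed_point[OF M chart g True] by metis
      have "T \<inter> E = {}"
      proof (rule ccontr)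
        assume "T \<inter> E \<noteq> {}"
        then obtain e where "e \<in> T" "e \<in> E"
          by blast
        then have "\<forall>w\<in>T. g w = w"
          using T(3)[OF _ E(1) _ E(2)] by blast
        then have "q \<in> E"
          using T(1,2) by (auto simp: E_def)
        with q show False
          by simp
      qed
      then show ?thesis
        using T(1,2) openin_subset[OF T(1)] by blast
    next
      case False
      have "closedin M {z \<in> topspace M. g z = z}"
        using Hausdorff cont by (intro closedin_continuous_maps_eq[of M]) auto
      then have "openin M (topspace M - {z \<in> topspace M. g z = z})"
        by blast
      then show ?thesis
        using q False E(2) by (intro exI[of _ "topspace M - {z \<in> topspace M. g z = z}"]) auto
    qed
  qed
  then have "closedin M E"
    using openin_subset[OF E(1)] by (simp add: closedin_def)
  moreover have "p \<in> E"
    using W unfolding E_def by blast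
  ultimately have "E = topspace M"
    using \<open>connected_space M\<close> E(1) unfolding connected_space_clopen_in by blast
  then show ?thesis
    using E(2) \<open>q \<in> topspace M\<close> by blast
qed

section \<open>The germ homomorphism\<close>

theorem lemma1p1:
  fixes n :: nat
    and M :: "'a topology"
    and A :: "('a set \<times> ('a \<Rightarrow> nat \<Rightarrow> real)) set"
    and G :: "('a \<Rightarrow> 'a) set"
    and p :: 'a
  assumes "real_analytic_manifold n M A"
    and "connected_space M"
    and "subgroup G (BijGroup (topspace M))"
    and "\<forall>g\<in>G. real_analytic_diffeo n M A g"
    and "derived_length (BijGroup (topspace M)\<lparr>carrier := G\<rparr>) < \<infinity>"
    and "p \<in> topspace M"
    and "\<forall>g\<in>G. g p = p"
  shows "derived_length (BijGroup (topspace M)\<lparr>carrier := G\<rparr>) \<le> psi n"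
proof -
  define \<Gamma> where "\<Gamma> = BijGroup (topspace M)\<lparr>carrier := G\<rparr>"
  let ?D = "Diff_germs n"
  interpret Gamma: group \<Gamma>
    unfolding \<Gamma>_def using subgroup.subgroup_is_group[OF assms(3) group_BijGroup] .
  have carrier: "carrier \<Gamma> = G"
    by (simp add: \<Gamma>_def)
  have Bij: "g \<in> Bij (topspace M)" if "g \<in> G" for g
    using subgroup.subset[OF assms(3)] that by (auto simp: BijGroup_def)
  have mult: "g \<otimes>\<^bsub>\<Gamma>\<^esub> h = compose (topspace M) g h" if "g \<in> G" "h \<in> G" for g h
    using that by (simp add: \<Gamma>_def BijGroup_def Bij)
  have one: "\<one>\<^bsub>\<Gamma>\<^esub> = (\<lambda>q\<in>topspace M. q)"
    by (simp add: \<Gamma>_def BijGroup_def)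
  have self_map: "real_analytic_self_map n M A g" and fix_p: "g p = p" if "g \<in> G" for g
    using assms(4,7) that by (auto simp: real_analytic_diffeo_def)
  obtain U x where chart: "(U, x) \<in> A" "p \<in> U"
    using chart_at[OF assms(1,6)] .
  note chart_facts = assms(1) chart
  define \<phi> where "\<phi> = centred_rep U x p"
  have "\<exists>F. complexifies n (\<phi> g) F" if "g \<in> G" for g
    unfolding \<phi>_def by (rule centred_rep_complexification[OF chart_facts self_map fix_p]) (fact that)+
  then obtain F where F: "\<And>g. g \<in> G \<Longrightarrow> complexifies n (\<phi> g) (F g)"
    by metis
  define \<Phi> where "\<Phi> g = germ n (F g)" for g
  have \<Phi>_mult: "\<Phi> (g \<otimes>\<^bsub>\<Gamma>\<^esub> h) = \<Phi> g \<otimes>\<^bsub>?D\<^esub> \<Phi> h" if gh: "g \<in> G" "h \<in> G" for g h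
  proof -
    have "g \<otimes>\<^bsub>\<Gamma>\<^esub> h \<in> G"
      using Gamma.m_closed gh by (simp add: carrier)
    moreover have "eventually (\<lambda>y. \<phi> (g \<otimes>\<^bsub>\<Gamma>\<^esub> h) y = \<phi> g (\<phi> h y)) (nhdsin (coord_space n) (\<lambda>_. 0))"
      unfolding \<phi>_def
      by (rule centred_rep_compose[OF chart_facts self_map[OF gh(2)] fix_p[OF gh(2)]])
         (simp only: mult[OF gh] compose_eq)
    ultimately have "eventually (\<lambda>z. F (g \<otimes>\<^bsub>\<Gamma>\<^esub> h) z = F g (F h z)) (nhdsin (coord_space n) origin)"
      using complexifies_compose[OF F F F] gh by blast
    then show ?thesis
      unfolding \<Phi>_def mult_Diff_germs[OF complexifies_tendsto[OF F[OF gh(2)]]] germ_eq_iff by simp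
  qed
  \<comment> \<open>The kernel is trivial by the identity principle.\<close>
  have \<Phi>_one_iff: "\<Phi> g = germ n id \<longleftrightarrow> g = \<one>\<^bsub>\<Gamma>\<^esub>" if g: "g \<in> G" for g
  proof
    assume "\<Phi> g = germ n id"
    then have "eventually (\<lambda>y. \<phi> g y = y) (nhdsin (coord_space n) (\<lambda>_. 0))"
      using complexifies_identity_iff[OF F[OF g]] by (simp add: \<Phi>_def germ_eq_iff)
    then obtain W where "openin M W" "p \<in> W" "\<forall>w\<in>W. g w = w"
      using centred_rep_identity_imp[OF chart_facts self_map[OF g] fix_p[OF g]] by (auto simp: \<phi>_def)
    then have "g q = q" if "q \<in> topspace M" for q
      using identity_principle_manifold[OF assms(1,2) self_map[OF g] _ _ _ that] by blast
    then show "g = \<one>\<^bsub>\<Gamma>\<^esub>"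
      unfolding one using Bij_imp_extensional[OF Bij[OF g]]
      by (intro extensionalityI[of _ "topspace M"]) auto
  next
    assume "g = \<one>\<^bsub>\<Gamma>\<^esub>"
    then have g_id: "g q = q" if "q \<in> topspace M" for q
      using that by (simp add: one)
    have "eventually (\<lambda>y. \<exists>w\<in>U \<inter> topspace M. (\<lambda>i. y i + x p i) = x w) (nhdsin (coord_space n) (\<lambda>_. 0))"
      by (rule eventually_near_chart_point[OF chart_facts]) (use assms(6) in auto)
    then have "eventually (\<lambda>y. \<phi> g y = y) (nhdsin (coord_space n) (\<lambda>_. 0))"
    proof eventually_elim
      case (elim y)
      then obtain w where w: "w \<in> U" "w \<in> topspace M" "(\<lambda>i. y i + x p i) = x w"
        by auto
      have "\<phi> g y = (\<lambda>i. x w i - x p i)"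
        unfolding \<phi>_def centred_rep_eq[OF chart_facts w(1,3)] g_id[OF w(2)] ..
      then show ?case
        by (simp flip: w(3))
    qed
    then show "\<Phi> g = germ n id"
      using complexifies_identity_iff[OF F[OF g]] by (simp add: \<Phi>_def germ_eq_iff)
  qed
  have one_G: "\<one>\<^bsub>\<Gamma>\<^esub> \<in> G" and inv_G: "\<And>g. g \<in> G \<Longrightarrow> inv\<^bsub>\<Gamma>\<^esub> g \<in> G"
    using Gamma.one_closed Gamma.inv_closed by (simp_all add: carrier)
  have \<Phi>_inv: "\<Phi> g \<otimes>\<^bsub>?D\<^esub> \<Phi> (inv\<^bsub>\<Gamma>\<^esub> g) = germ n id" "\<Phi> (inv\<^bsub>\<Gamma>\<^esub> g) \<otimes>\<^bsub>?D\<^esub> \<Phi> g = germ n id"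
    if "g \<in> G" for g
    using that Gamma.r_inv[of g] Gamma.l_inv[of g] \<Phi>_one_iff[OF one_G] inv_G[OF that]
    by (simp_all add: carrier flip: \<Phi>_mult)
  \<comment> \<open>The germs of \<open>g\<close> and of its inverse in \<open>G\<close> are inverse to each other, which makes them germs of
    diffeomorphisms.\<close>
  have \<Phi>_carrier: "\<Phi> g \<in> carrier ?D" if g: "g \<in> G" for g
  proof -
    have "eventually (\<lambda>z. F g (F (inv\<^bsub>\<Gamma>\<^esub> g) z) = z) (nhdsin (coord_space n) origin)"
      "eventually (\<lambda>z. F (inv\<^bsub>\<Gamma>\<^esub> g) (F g z) = z) (nhdsin (coord_space n) origin)"
      using \<Phi>_inv[OF g] inv_G[OF g] g F
      by (simp_all add: \<Phi>_def mult_Diff_germs[OF complexifies_tendsto[OF F]] germ_eq_iff)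
    then obtain V V' where "analytic_diffeo n V V' (F g)" "origin \<in> V"
      using complexifies_analytic_diffeo[OF F[OF g] F[OF inv_G[OF g]]] by blast
    moreover have "F g origin = origin"
      using F[OF g] by (simp add: complexifies_def)
    ultimately show ?thesis
      by (auto simp: Diff_germs_def \<Phi>_def)
  qed
  have \<Phi>_hom: "\<Phi> \<in> hom \<Gamma> ?D"
    using \<Phi>_carrier \<Phi>_mult by (simp add: hom_def Pi_iff carrier)
  have \<Phi>_inj: "inj_on \<Phi> G"
  proof (rule inj_onI)
    fix g h assume gh: "g \<in> G" "h \<in> G" "\<Phi> g = \<Phi> h"
    have "\<Phi> (g \<otimes>\<^bsub>\<Gamma>\<^esub> inv\<^bsub>\<Gamma>\<^esub> h) = germ n id"
      using gh \<Phi>_inv(1)[OF gh(2)] by (simp add: \<Phi>_mult inv_G)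
    then have "g \<otimes>\<^bsub>\<Gamma>\<^esub> inv\<^bsub>\<Gamma>\<^esub> h = \<one>\<^bsub>\<Gamma>\<^esub>"
      using \<Phi>_one_iff Gamma.m_closed inv_G gh by (simp add: carrier)
    then show "g = h"
      using Gamma.inv_equality[of g "inv\<^bsub>\<Gamma>\<^esub> h"] gh inv_G by (simp add: carrier)
  qed
  have subgroup: "subgroup (\<Phi> ` G) ?D"
  proof
    show "\<Phi> ` G \<subseteq> carrier ?D"
      using \<Phi>_carrier by blast
    show "a \<otimes>\<^bsub>?D\<^esub> b \<in> \<Phi> ` G" if "a \<in> \<Phi> ` G" "b \<in> \<Phi> ` G" for a b
      using that Gamma.m_closed by (auto simp: carrier simp flip: \<Phi>_mult)
    show "\<one>\<^bsub>?D\<^esub> \<in> \<Phi> ` G"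
      using \<Phi>_one_iff[OF one_G] one_G by (auto simp: Diff_germs_def intro: rev_image_eqI)
    show "inv\<^bsub>?D\<^esub> a \<in> \<Phi> ` G" if a: "a \<in> \<Phi> ` G" for a
    proof -
      obtain g where g: "g \<in> G" "a = \<Phi> g"
        using a by blast
      then have "inv\<^bsub>?D\<^esub> a = \<Phi> (inv\<^bsub>\<Gamma>\<^esub> g)"
        using inv_Diff_germs_eq[OF \<Phi>_carrier \<Phi>_carrier \<Phi>_inv] inv_G by simp
      with inv_G[OF g(1)] show ?thesis
        by simp
    qed
  qed
  have "\<Phi> \<one>\<^bsub>\<Gamma>\<^esub> = \<one>\<^bsub>?D\<^esub>"
    using \<Phi>_one_iff[OF one_G] by (simp add: Diff_germs_def)
  then have "derived_length (?D\<lparr>carrier := \<Phi> ` G\<rparr>) = derived_length \<Gamma>"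
    using derived_length_hom_image[OF Gamma.group_axioms \<Phi>_hom] \<Phi>_inj by (simp add: carrier)
  moreover have "derived_length \<Gamma> < \<infinity>"
    using assms(5) by (simp add: \<Gamma>_def)
  ultimately have "derived_length \<Gamma> \<le> psi n"
    unfolding psi_def using subgroup
    by (intro Sup_upper) (auto intro!: exI[of _ "\<Phi> ` G"])
  then show ?thesis
    by (simp add: \<Gamma>_def)
qed

end
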